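(* Let $p,q\ge 2$ be integers and let $G$ be a finite simple semiregular graph with edge set $E$ and edge degree $p+q$, i.e. $G$ is a finite simple connected bipartite graph in which every edge connects a vertex of degree $p+1$ to a vertex of degree $q+1$. There is a constant $C_G>0$ depending only on $G$ such that for every function $f:E\to\mathbb{R}$ there is a number $\beta_{\max}\in\{(pq)^{-1/2}\}\cup[(pq)^{-1/4},1)$ such that for every directed edge $a$ in $G$ and every integer $r\ge 0$ $$\Big|M_{r,a}(f)-\frac{1}{|E|}\sum_{e\in E}f(e)\Big|\le C_G\,\|f\|_2\,\beta_{\max}^{\,r}.$$
   Context: Simple means no loops and no multiple edges. The edge degree of $e$ is the number of edges meeting $e$ in either of its endpoints. The norm is $\|f\|_2=\langle f,f\rangle^{1/2}$ with $\langle f,g\rangle=\sum_{e\in E}f(e)g(e)$. Universal cover: $\widetilde G$ is the universal covering tree of $G$, with vertex set $\widetilde V$ and edge set $\widetilde E$: fix a root vertex of $G$; the vertices of $\widetilde G$ are the non-backtracking paths in $G$ starting at the root, two being adjacent if they differ by exactly one edge at the end. The projection $\pi:\widetilde G\to G$ sends a path to its end vertex, and $\pi(\{\tilde v,\tilde w\})=\{\pi(\tilde v),\pi(\tilde w)\}$ on edges. The lift of $f$ is $\tilde f=f\circ\pi$. $\delta$ is the combinatorial distance between vertices. Edge spheres and arcs: for $v_0\in\widetilde V$, $S'_r(v_0)=\{e=\{x,y\}\in\widetilde E:\min\{\delta(x,v_0),\delta(y,v_0)\}=r\}$. For a directed edge $a$ of $\widetilde G$ from $w'$ to $w$, the edge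 arcs are $A'_0(a)=\{a\}$ and $A'_{r+1}(a)=S'_{r+1}(w')\cap S'_r(w)$ for $r\ge0$. The arc average is $$M_{r,a}(f)=\frac{1}{|A'_r(a)|}\sum_{x\in A'_r(a)}\tilde f(x).$$ For a directed edge $a$ of $G$, $M_{r,a}(f)$ is computed using any lift of $a$ to a directed edge of $\widetilde G$ (the value does not depend on the lift). The constant $C_G$ does not depend on $a$, $f$, $r$; the rate $\beta_{\max}$ may depend on $G$ and $f$ but not on $a$ or $r$. *)

theory Defs
  imports Complex_Main
begin

type_synonym 'a graph = "'a set \<times> 'a set set"

abbreviation verts :: "'a graph \<Rightarrow> 'a set" where "verts G \<equiv> fst G"
abbreviation edges :: "'a graph \<Rightarrow> 'a set set" where "edges G \<equiv> snd G"

definition simple_graph :: "'a graph \<Rightarrow> bool" where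
  "simple_graph G \<longleftrightarrow>
     (\<forall>e\<in>edges G. \<exists>u v. u \<in> verts G \<and> v \<in> verts G \<and> u \<noteq> v \<and> e = {u, v})"

definition walk :: "'a graph \<Rightarrow> 'a list \<Rightarrow> bool" where
  "walk G xs \<longleftrightarrow>
     xs \<noteq> [] \<and> set xs \<subseteq> verts G \<and> (\<forall>i. Suc i < length xs \<longrightarrow> {xs ! i, xs ! Suc i} \<in> edges G)"

definition connected_graph :: "'a graph \<Rightarrow> bool" where
  "connected_graph G \<longleftrightarrow>
     verts G \<noteq> {} \<and>
     (\<forall>u\<in>verts G. \<forall>v\<in>verts G. \<exists>xs. walk G xs \<and> hd xs = u \<and> last xs = v)"

definition bipartite_graph :: "'a graph \<Rightarrow> bool" where
  "bipartite_graph G \<longleftrightarrow>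
     (\<exists>A B. A \<union> B = verts G \<and> A \<inter> B = {} \<and> (\<forall>e\<in>edges G. \<exists>a\<in>A. \<exists>b\<in>B. e = {a, b}))"

definition vertex_degree :: "'a graph \<Rightarrow> 'a \<Rightarrow> nat" where
  "vertex_degree G v = card {e \<in> edges G. v \<in> e}"

definition edge_degree :: "'a graph \<Rightarrow> 'a set \<Rightarrow> nat" where
  "edge_degree G e = card {e' \<in> edges G. e' \<noteq> e \<and> e' \<inter> e \<noteq> {}}"

definition semiregular :: "'a graph \<Rightarrow> nat \<Rightarrow> nat \<Rightarrow> bool" where
  "semiregular G p q \<longleftrightarrow>
     finite (verts G) \<and> simple_graph G \<and> connected_graph G \<and> bipartite_graph G \<and>
     (\<forall>e\<in>edges G. \<exists>u v. e = {u, v} \<and> vertex_degree G u = p + 1 \<and> vertex_degree G v = q + 1)"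

lemma semiregular_edge_degree:
  assumes "semiregular G p q" "e \<in> edges G"
  shows "edge_degree G e = p + q"
proof -
  from assms obtain u v where uv: "e = {u, v}" "vertex_degree G u = p + 1" "vertex_degree G v = q + 1"
    unfolding semiregular_def by blast
  have simple: "\<exists>x y. e' = {x, y} \<and> x \<noteq> y" if "e' \<in> edges G" for e'
    using assms(1) that unfolding semiregular_def simple_graph_def by blast
  have "u \<noteq> v" using simple[OF assms(2)] uv(1) by auto
  define A B where "A = {e' \<in> edges G. u \<in> e'}" and "B = {e' \<in> edges G. v \<in> e'}"
  have "finite A" "finite B"
    using uv(2,3) unfolding vertex_degree_def A_def B_def by (simp_all add: card_ge_0_finite)
  moreover have "e \<in> A" "e \<in> B" using assms(2) uv(1) unfolding A_def B_def by auto
  moreover have "A \<inter> B = {e}"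
  proof -
    have "e' = e" if "e' \<in> A" "e' \<in> B" for e'
    proof -
      obtain x y where "e' = {x, y}" using simple[of e'] \<open>e' \<in> A\<close> unfolding A_def by blast
      then show ?thesis using that \<open>u \<noteq> v\<close> uv(1) unfolding A_def B_def by auto
    qed
    then show ?thesis using \<open>e \<in> A\<close> \<open>e \<in> B\<close> by blast
  qed
  then have "(A - {e}) \<inter> (B - {e}) = {}" by auto
  moreover have "card A = p + 1" "card B = q + 1"
    using uv(2,3) unfolding vertex_degree_def A_def B_def by simp_all
  ultimately have "card ((A - {e}) \<union> (B - {e})) = p + q"
    by (simp add: card_Un_disjoint card_Diff_singleton)
  moreover have "{e' \<in> edges G. e' \<noteq> e \<and> e' \<inter> e \<noteq> {}} = (A - {e}) \<union> (B - {e})"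
    unfolding A_def B_def uv(1) by auto
  ultimately show ?thesis by (simp add: edge_degree_def)
qed

definition graph_dist :: "'a graph \<Rightarrow> 'a \<Rightarrow> 'a \<Rightarrow> nat" where
  "graph_dist G u v =
     (LEAST n. \<exists>xs. walk G xs \<and> hd xs = u \<and> last xs = v \<and> length xs = Suc n)"

definition non_backtracking :: "'a list \<Rightarrow> bool" where
  "non_backtracking xs \<longleftrightarrow> (\<forall>i. Suc (Suc i) < length xs \<longrightarrow> xs ! i \<noteq> xs ! Suc (Suc i))"

definition cover_verts :: "'a graph \<Rightarrow> 'a \<Rightarrow> 'a list set" where
  "cover_verts G x0 = {xs. walk G xs \<and> non_backtracking xs \<and> hd xs = x0}"

definition universal_cover :: "'a graph \<Rightarrow> 'a \<Rightarrow> 'a list graph" where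
  "universal_cover G x0 =
     (cover_verts G x0,
      {{xs, xs @ [x]} | xs x. xs \<in> cover_verts G x0 \<and> xs @ [x] \<in> cover_verts G x0})"

text \<open>The covering projection sends a path to its end vertex, that is, it is \<^const>\<open>last\<close>;
  on edges it acts by taking images.\<close>

definition lift :: "('a set \<Rightarrow> real) \<Rightarrow> 'a list set \<Rightarrow> real" where
  "lift f e = f (last ` e)"

definition edge_sphere :: "'a graph \<Rightarrow> nat \<Rightarrow> 'a \<Rightarrow> 'a set set" where
  "edge_sphere T r v0 =
     {e \<in> edges T. \<exists>x y. e = {x, y} \<and> min (graph_dist T x v0) (graph_dist T y v0) = r}"

text \<open>A directed edge is given as the pair of its initial and its terminal vertex.\<close>

definition directed_edges :: "'a graph \<Rightarrow> ('a \<times> 'a) set" where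
  "directed_edges G = {(u, v). {u, v} \<in> edges G}"

fun edge_arc :: "'a graph \<Rightarrow> nat \<Rightarrow> 'a \<times> 'a \<Rightarrow> 'a set set" where
  "edge_arc T 0 (w', w) = {{w', w}}"
| "edge_arc T (Suc r) (w', w) = edge_sphere T (Suc r) w' \<inter> edge_sphere T r w"

definition arc_average :: "'a graph \<Rightarrow> 'a \<Rightarrow> nat \<Rightarrow> 'a list \<times> 'a list \<Rightarrow> ('a set \<Rightarrow> real) \<Rightarrow> real" where
  "arc_average G x0 r a f =
     (\<Sum>e\<in>edge_arc (universal_cover G x0) r a. lift f e)
       / real (card (edge_arc (universal_cover G x0) r a))"

definition edge_lifts :: "'a graph \<Rightarrow> 'a \<Rightarrow> 'a \<times> 'a \<Rightarrow> ('a list \<times> 'a list) set" where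
  "edge_lifts G x0 a =
     {b \<in> directed_edges (universal_cover G x0). map_prod last last b = a}"

lemma cover_step:
  assumes "simple_graph G" "xs \<in> cover_verts G x0" "{last xs, v} \<in> edges G"
  shows "\<exists>ys\<in>cover_verts G x0. last ys = v \<and> {xs, ys} \<in> edges (universal_cover G x0)"
proof -
  have xs: "walk G xs" "non_backtracking xs" "hd xs = x0" "xs \<noteq> []"
    using assms(2) by (auto simp: cover_verts_def walk_def)
  have "v \<in> verts G"
    using assms(1,3) unfolding simple_graph_def by (metis doubleton_eq_iff)
  show ?thesis
  proof (cases "2 \<le> length xs \<and> xs ! (length xs - 2) = v")
    case True
    obtain z zs where z: "xs = zs @ [z]" "zs \<noteq> []"
      using True by (cases xs rule: rev_cases) force+
    have pre: "xs ! i = zs ! i" if "i < length zs" for i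
      using z that by (simp add: nth_append)
    have "{zs ! i, zs ! Suc i} \<in> edges G" if "Suc i < length zs" for i
    proof -
      have "{xs ! i, xs ! Suc i} \<in> edges G" using xs(1) that z(1) by (simp add: walk_def)
      then show ?thesis using pre[of i] pre[of "Suc i"] that by simp
    qed
    then have "walk G zs" using xs(1) z by (simp add: walk_def)
    moreover have "non_backtracking zs"
      unfolding non_backtracking_def
    proof (intro allI impI)
      fix i assume i: "Suc (Suc i) < length zs"
      then have "xs ! i \<noteq> xs ! Suc (Suc i)" using xs(2) z by (simp add: non_backtracking_def)
      then show "zs ! i \<noteq> zs ! Suc (Suc i)" using pre[of i] pre[of "Suc (Suc i)"] i by simp
    qed
    ultimately have "butlast xs \<in> cover_verts G x0"
      using xs(3) z by (simp add: cover_verts_def)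
    moreover have "last (butlast xs) = v"
    proof -
      have "butlast xs \<noteq> []" using True by (cases xs) auto
      then have "last (butlast xs) = butlast xs ! (length xs - 2)"
        by (simp add: last_conv_nth numeral_2_eq_2)
      also have "\<dots> = v" using True by (subst nth_butlast) auto
      finally show ?thesis .
    qed
    moreover have "{xs, butlast xs} \<in> edges (universal_cover G x0)"
    proof -
      have "butlast xs @ [last xs] = xs" using xs(4) by simp
      then have "\<exists>zs z. {xs, butlast xs} = {zs, zs @ [z]} \<and>
          zs \<in> cover_verts G x0 \<and> zs @ [z] \<in> cover_verts G x0"
        using assms(2) \<open>butlast xs \<in> cover_verts G x0\<close> by (metis insert_commute)
      then show ?thesis by (simp add: universal_cover_def)
    qed
    ultimately show ?thesis by blast
  next
    case False
    have "walk G (xs @ [v])"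
      unfolding walk_def
    proof (intro conjI allI impI)
      fix i assume i: "Suc i < length (xs @ [v])"
      show "{(xs @ [v]) ! i, (xs @ [v]) ! Suc i} \<in> edges G"
      proof (cases "Suc i < length xs")
        case True
        then show ?thesis using xs(1) by (simp add: walk_def nth_append)
      next
        case False
        then have "length xs = Suc i" using i by simp
        then show ?thesis using assms(3) xs(4) by (simp add: nth_append last_conv_nth)
      qed
    qed (use xs(1) \<open>v \<in> verts G\<close> in \<open>auto simp: walk_def\<close>)
    moreover have "non_backtracking (xs @ [v])"
      unfolding non_backtracking_def
    proof (intro allI impI)
      fix i assume i: "Suc (Suc i) < length (xs @ [v])"
      show "(xs @ [v]) ! i \<noteq> (xs @ [v]) ! Suc (Suc i)"
      proof (cases "Suc (Suc i) < length xs")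
        case True
        then show ?thesis using xs(2) by (simp add: non_backtracking_def nth_append)
      next
        case F: False
        then have "length xs = Suc (Suc i)" using i by simp
        then show ?thesis using False by (simp add: nth_append)
      qed
    qed
    ultimately have "xs @ [v] \<in> cover_verts G x0"
      using xs by (simp add: cover_verts_def)
    then show ?thesis
      using assms(2) by (intro bexI[of _ "xs @ [v]"]) (auto simp: universal_cover_def)
  qed
qed

lemma cover_vert_exists:
  assumes "simple_graph G" "walk G xs"
  shows "\<exists>ys\<in>cover_verts G (hd xs). last ys = last xs"
  using assms(2)
proof (induction xs rule: rev_induct)
  case Nil
  then show ?case by (simp add: walk_def)
next
  case (snoc x xs)
  show ?case
  proof (cases "xs = []")
    case True
    then have "[x] \<in> cover_verts G x"
      using snoc.prems by (auto simp: cover_verts_def walk_def non_backtracking_def)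
    then show ?thesis using True by force
  next
    case False
    have edge: "{(xs @ [x]) ! i, (xs @ [x]) ! Suc i} \<in> edges G" if "Suc i < Suc (length xs)" for i
      using snoc.prems that by (simp add: walk_def)
    have "walk G xs"
      unfolding walk_def
    proof (intro conjI allI impI)
      fix i assume "Suc i < length xs"
      then show "{xs ! i, xs ! Suc i} \<in> edges G" using edge[of i] by (simp add: nth_append)
    qed (use False snoc.prems in \<open>auto simp: walk_def\<close>)
    then obtain ys where ys: "ys \<in> cover_verts G (hd xs)" "last ys = last xs"
      using snoc.IH by blast
    have "{last ys, x} \<in> edges G"
      using edge[of "length xs - 1"] False ys(2) by (simp add: nth_append last_conv_nth)
    from cover_step[OF assms(1) ys(1) this] show ?thesis using False by auto
  qed
qed

lemma edge_lifts_nonempty: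
  assumes "simple_graph G" "connected_graph G" "x0 \<in> verts G" "a \<in> directed_edges G"
  shows "edge_lifts G x0 a \<noteq> {}"
proof -
  obtain u v where a: "a = (u, v)" "{u, v} \<in> edges G"
    using assms(4) by (auto simp: directed_edges_def)
  then have "u \<in> verts G"
    using assms(1) unfolding simple_graph_def by (metis doubleton_eq_iff)
  then obtain xs where "walk G xs" "hd xs = x0" "last xs = u"
    using assms(2,3) unfolding connected_graph_def by blast
  then obtain ys where ys: "ys \<in> cover_verts G x0" "last ys = u"
    using cover_vert_exists[OF assms(1)] by metis
  then obtain zs where "last zs = v" "{ys, zs} \<in> edges (universal_cover G x0)"
    using cover_step[OF assms(1) ys(1), of v] a(2) by auto
  then have "(ys, zs) \<in> edge_lifts G x0 a"
    using ys(2) a(1) by (simp add: edge_lifts_def directed_edges_def)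
  then show ?thesis by blast
qed

definition edge_inner :: "'a graph \<Rightarrow> ('a set \<Rightarrow> real) \<Rightarrow> ('a set \<Rightarrow> real) \<Rightarrow> real" where
  "edge_inner G f g = (\<Sum>e\<in>edges G. f e * g e)"

definition edge_norm :: "'a graph \<Rightarrow> ('a set \<Rightarrow> real) \<Rightarrow> real" where
  "edge_norm G f = sqrt (edge_inner G f f)"

end

theory Submission
  imports Defs "HOL-Library.Sublist" "HOL-Analysis.Function_Topology"
begin

text \<open>
  Because \<open>\<beta>\<close> may be any number in \<open>[(p q) powr (- 1 / 4), 1)\<close>, what has to be shown is that arc averages
  converge to the mean of \<open>f\<close> exponentially fast, at some rate below 1 that is uniform in the
  starting edge and in \<open>f\<close>.

  In the universal covering tree the arc of radius \<open>r + 1\<close> of a directed edge is the disjoint union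
  of the arcs of radius \<open>r\<close> of the directed edges that continue it without turning back
  (\<open>edge_arc_Suc\<close>, \<open>edge_arc_disjoint\<close>). In a semiregular graph these smaller arcs all have the same
  size, so the uniform average over an arc is the \<open>r\<close>-th iterate of the operator \<open>P\<close> that replaces a
  function on directed edges by its mean over the continuations (\<open>arc_average_eq_iterate\<close>). This
  turns a question about the infinite tree into one about a finite matrix.

  At a vertex of degree \<open>d\<close> the operator sends the values \<open>h u\<close> on the outgoing edges to the means over
  all outgoing edges but one. It preserves constants and multiplies functions of sum zero by
  \<open>- 1 / (d - 1)\<close>, a strict contraction when \<open>d \<ge> 3\<close>. Hence \<open>P\<close> does not increase the Euclidean norm, and
  \<open>P g\<close> has the same norm as \<open>g\<close> only if \<open>g\<close> is constant on the edges leaving each vertex. If two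
  successive steps both preserve the norm, this holds for \<open>g\<close> and for \<open>P g\<close>; then the value of \<open>g\<close> on the
  edges leaving \<open>v\<close> is unchanged when \<open>v\<close> is moved by two steps, and by connectedness \<open>g\<close> takes only two
  values, one for each of the two directions across the bipartition
  (\<open>energy_two_steps_eqD\<close>). So \<open>P\<^sup>2\<close> strictly contracts every nonzero function whose sum over each
  of these two classes of directed edges vanishes. Compactness of the unit sphere makes the
  contraction factor uniform (\<open>strict_contraction_uniform\<close>), and \<open>P\<close> preserves the two vanishing
  sums up to exchanging them, so the contraction can be iterated. A function of undirected edges
  minus its mean satisfies both conditions, which gives the theorem.
\<close>

section \<open>Distances in the universal cover\<close>

definition nbrs :: "'a graph \<Rightarrow> 'a \<Rightarrow> 'a set" where
  "nbrs G v = {w. {v, w} \<in> edges G}"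

lemma nbrs_sym: "w \<in> nbrs G v \<longleftrightarrow> v \<in> nbrs G w"
  by (simp add: nbrs_def insert_commute)

text \<open>
  Distance in the tree of all lists, where a list is joined to its one-element extensions: two lists
  are joined by going up to their longest common prefix and down again.
\<close>

fun prefix_dist :: "'a list \<Rightarrow> 'a list \<Rightarrow> nat" where
  "prefix_dist [] ys = length ys"
| "prefix_dist (x # xs) [] = Suc (length xs)"
| "prefix_dist (x # xs) (y # ys) =
     (if x = y then prefix_dist xs ys else 2 + length xs + length ys)"

lemma prefix_dist_Nil2 [simp]: "prefix_dist xs [] = length xs"
  by (cases xs) auto

lemma prefix_dist_sym: "prefix_dist xs ys = prefix_dist ys xs"
  by (induction xs ys rule: prefix_dist.induct) auto

lemma prefix_dist_eq_0: "prefix_dist xs ys = 0 \<longleftrightarrow> xs = ys"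
  by (induction xs ys rule: prefix_dist.induct) auto

lemma prefix_dist_snoc_towards:
  "prefix (ys @ [v]) xs \<Longrightarrow> prefix_dist xs ys = Suc (prefix_dist xs (ys @ [v]))"
  by (induction xs ys rule: prefix_dist.induct) (auto simp: prefix_def)

lemma prefix_dist_snoc_away:
  "\<not> prefix (ys @ [v]) xs \<Longrightarrow> prefix_dist xs (ys @ [v]) = Suc (prefix_dist xs ys)"
  by (induction xs ys rule: prefix_dist.induct) auto

lemma cover_verts_not_Nil: "w \<in> cover_verts G x0 \<Longrightarrow> w \<noteq> []"
  by (auto simp: cover_verts_def walk_def)

lemma walk_snocI:
  assumes "walk G xs" and "{last xs, v} \<in> edges G" and "v \<in> verts G"
  shows "walk G (xs @ [v])"
  unfolding walk_def
proof (intro conjI allI impI)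
  fix i assume i: "Suc i < length (xs @ [v])"
  show "{(xs @ [v]) ! i, (xs @ [v]) ! Suc i} \<in> edges G"
  proof (cases "Suc i < length xs")
    case True
    then show ?thesis using assms(1) by (simp add: walk_def nth_append)
  next
    case False
    then have "length xs = Suc i" "xs \<noteq> []" using i assms(1) by (auto simp: walk_def)
    then show ?thesis using assms(2) by (simp add: nth_append last_conv_nth)
  qed
qed (use assms in \<open>auto simp: walk_def\<close>)

lemma walk_snocD:
  assumes "walk G (xs @ [v])" and "xs \<noteq> []"
  shows "walk G xs" "{last xs, v} \<in> edges G"
proof -
  have step: "{(xs @ [v]) ! i, (xs @ [v]) ! Suc i} \<in> edges G" if "i < length xs" for i
    using assms(1) that by (simp add: walk_def)
  have "{xs ! i, xs ! Suc i} \<in> edges G" if "Suc i < length xs" for i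
    using step[of i] that by (simp add: nth_append)
  then show "walk G xs"
    using assms by (simp add: walk_def)
  show "{last xs, v} \<in> edges G"
    using step[of "length xs - 1"] assms(2) by (simp add: nth_append last_conv_nth)
qed

lemma cover_verts_snocD:
  assumes "w @ [v] \<in> cover_verts G x0" and "w \<noteq> []"
  shows "w \<in> cover_verts G x0" "{last w, v} \<in> edges G"
proof -
  have walk: "walk G (w @ [v])" and nb: "non_backtracking (w @ [v])" and hd: "hd w = x0"
    using assms by (auto simp: cover_verts_def)
  have "w ! i \<noteq> w ! Suc (Suc i)" if "Suc (Suc i) < length w" for i
  proof -
    have "(w @ [v]) ! i \<noteq> (w @ [v]) ! Suc (Suc i)"
      using nb that by (simp add: non_backtracking_def)
    then show ?thesis using that by (simp add: nth_append)
  qed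
  then show "w \<in> cover_verts G x0"
    using walk_snocD(1)[OF walk assms(2)] hd by (simp add: cover_verts_def non_backtracking_def)
  show "{last w, v} \<in> edges G"
    using walk assms(2) by (rule walk_snocD(2))
qed

lemma cover_verts_prefix:
  "w @ us \<in> cover_verts G x0 \<Longrightarrow> w \<noteq> [] \<Longrightarrow> w \<in> cover_verts G x0"
proof (induction us rule: rev_induct)
  case (snoc u us)
  then show ?case using cover_verts_snocD(1)[of "w @ us" u] by simp
qed simp

lemma cover_nbrs_iff:
  "w' \<in> nbrs (universal_cover G x0) w \<longleftrightarrow>
     w \<in> cover_verts G x0 \<and> w' \<in> cover_verts G x0 \<and> (\<exists>x. w' = w @ [x] \<or> w = w' @ [x])"
  by (auto simp: nbrs_def universal_cover_def doubleton_eq_iff)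

text \<open>
  Every edge of the cover can be listed with the end closer to a given vertex first; this removes the
  symmetry from later arguments about edge spheres.
\<close>

lemma cover_edge_ends:
  assumes "e \<in> edges (universal_cover G x0)"
  obtains x y where "e = {x, y}" "y \<in> nbrs (universal_cover G x0) x"
    "prefix_dist x v \<le> prefix_dist y v"
proof -
  obtain x y where e: "e = {x, y}" "y \<in> nbrs (universal_cover G x0) x"
    using assms unfolding cover_nbrs_iff by (auto simp: universal_cover_def)
  then have "e = {y, x}" "x \<in> nbrs (universal_cover G x0) y"
    using nbrs_sym[of y _ x] by auto
  then show thesis
    using that[of x y] that[of y x] e by linarith
qed

lemma prefix_dist_step:
  assumes "w' \<in> nbrs (universal_cover G x0) w"
  shows "prefix_dist x w' = Suc (prefix_dist x w) \<or> prefix_dist x w = Suc (prefix_dist x w')"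
  using assms prefix_dist_snoc_towards prefix_dist_snoc_away
  unfolding cover_nbrs_iff by metis

text \<open>
  This is where the absence of cycles in the cover enters: only one neighbour lies in the direction of
  \<open>x\<close>. It is the extension of \<open>w\<close> along \<open>x\<close> if \<open>w\<close> is a prefix of \<open>x\<close>, and the list \<open>w\<close> without its last entry
  otherwise.
\<close>

lemma prefix_dist_unique_closer:
  assumes "w1 \<in> nbrs (universal_cover G x0) w" and "w2 \<in> nbrs (universal_cover G x0) w"
    and "w1 \<noteq> w2" and "prefix_dist x w = Suc (prefix_dist x w1)"
  shows "prefix_dist x w2 = Suc (prefix_dist x w)"
proof (rule ccontr)
  assume "prefix_dist x w2 \<noteq> Suc (prefix_dist x w)"
  then have "prefix_dist x w = Suc (prefix_dist x w2)"
    using prefix_dist_step[OF assms(2)] by blast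
  have closer: "(\<exists>v. w' = w @ [v] \<and> prefix (w @ [v]) x) \<or> (\<exists>v. w = w' @ [v] \<and> \<not> prefix w x)"
    if "w' \<in> nbrs (universal_cover G x0) w" "prefix_dist x w = Suc (prefix_dist x w')" for w'
    using that prefix_dist_snoc_towards[of w _ x] prefix_dist_snoc_towards[of w' _ x]
      prefix_dist_snoc_away[of w _ x] unfolding cover_nbrs_iff by fastforce
  from closer[OF assms(1,4)] closer[OF assms(2) \<open>prefix_dist x w = Suc (prefix_dist x w2)\<close>]
  show False
    using assms(3) by (auto simp: prefix_def)
qed

lemma prefix_dist_closer_exists:
  assumes "x \<in> cover_verts G x0" and "w \<in> cover_verts G x0" and "x \<noteq> w"
  shows "\<exists>w'\<in>nbrs (universal_cover G x0) w. prefix_dist x w = Suc (prefix_dist x w')"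
proof (cases "prefix w x")
  case True
  then obtain v us where x: "x = (w @ [v]) @ us"
    using assms(3) by (metis append.assoc append_Cons append_Nil append_Nil2 neq_Nil_conv prefixE)
  then have "w @ [v] \<in> cover_verts G x0"
    using assms(1) cover_verts_prefix[of "w @ [v]" us] by simp
  then have "w @ [v] \<in> nbrs (universal_cover G x0) w"
    using assms(2) by (simp add: cover_nbrs_iff)
  moreover have "prefix_dist x w = Suc (prefix_dist x (w @ [v]))"
    using x by (intro prefix_dist_snoc_towards) (simp add: prefix_def)
  ultimately show ?thesis by blast
next
  case False
  obtain b v where w: "w = b @ [v]"
    using cover_verts_not_Nil[OF assms(2)] by (cases w rule: rev_cases) auto
  have "b \<noteq> []"
  proof
    assume "b = []"
    then have "w = [x0]" using assms(2) w by (simp add: cover_verts_def)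
    moreover have "hd x = x0" "x \<noteq> []"
      using assms(1) by (auto simp: cover_verts_def walk_def)
    ultimately show False using False by (cases x) auto
  qed
  then have "b \<in> nbrs (universal_cover G x0) w"
    using assms(2) w cover_verts_snocD(1)[of b v] by (simp add: cover_nbrs_iff)
  moreover have "prefix_dist x w = Suc (prefix_dist x b)"
    using False w by (simp add: prefix_dist_snoc_away)
  ultimately show ?thesis by blast
qed

lemma cover_walk_exists:
  assumes "x \<in> cover_verts G x0" and "y \<in> cover_verts G x0"
  shows "\<exists>xs. walk (universal_cover G x0) xs \<and> hd xs = x \<and> last xs = y
            \<and> length xs = Suc (prefix_dist x y)"
  using assms(2)
proof (induction "prefix_dist x y" arbitrary: y)
  case 0
  then have "x = y" by (metis prefix_dist_eq_0)
  then show ?case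
    using assms(1) prefix_dist_eq_0[of x x]
    by (intro exI[of _ "[x]"]) (auto simp: walk_def universal_cover_def)
next
  case (Suc n)
  then have "x \<noteq> y" by (metis prefix_dist_eq_0 nat.distinct(1))
  then obtain z where z: "z \<in> nbrs (universal_cover G x0) y" "prefix_dist x y = Suc (prefix_dist x z)"
    using prefix_dist_closer_exists[OF assms(1) Suc.prems] by blast
  then have "z \<in> cover_verts G x0" "n = prefix_dist x z"
    using Suc.hyps(2) by (auto simp: cover_nbrs_iff)
  then obtain xs where xs: "walk (universal_cover G x0) xs" "hd xs = x" "last xs = z"
      "length xs = Suc (prefix_dist x z)"
    using Suc.hyps(1) by blast
  have "walk (universal_cover G x0) (xs @ [y])"
    using z(1) xs(3) Suc.prems
    by (intro walk_snocI[OF xs(1)]) (auto simp: nbrs_def insert_commute universal_cover_def)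
  then show ?case
    using xs z(2) by (intro exI[of _ "xs @ [y]"]) (auto simp: walk_def)
qed

lemma prefix_dist_less_walk_length:
  "walk (universal_cover G x0) xs \<Longrightarrow> prefix_dist (hd xs) (last xs) < length xs"
proof (induction xs rule: rev_induct)
  case (snoc y xs)
  show ?case
  proof (cases "xs = []")
    case True
    then show ?thesis using prefix_dist_eq_0[of y y] by simp
  next
    case False
    then have "y \<in> nbrs (universal_cover G x0) (last xs)"
      using walk_snocD(2)[OF snoc.prems] by (simp add: nbrs_def)
    then show ?thesis
      using prefix_dist_step[of y G x0 "last xs" "hd xs"] snoc.IH[OF walk_snocD(1)[OF snoc.prems False]]
        False by auto
  qed
qed (simp add: walk_def)

text \<open>
  The distance changes by one along every edge, which bounds walks from below. Some neighbour of \<open>y\<close> is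
  closer to \<open>x\<close> unless \<open>x = y\<close>, which yields a walk attaining the bound.
\<close>

lemma cover_graph_dist:
  assumes "x \<in> cover_verts G x0" and "y \<in> cover_verts G x0"
  shows "graph_dist (universal_cover G x0) x y = prefix_dist x y"
  unfolding graph_dist_def
proof (rule Least_equality)
  fix n
  assume "\<exists>xs. walk (universal_cover G x0) xs \<and> hd xs = x \<and> last xs = y \<and> length xs = Suc n"
  then show "prefix_dist x y \<le> n"
    using prefix_dist_less_walk_length by fastforce
qed (rule cover_walk_exists[OF assms])

section \<open>Edge arcs branch\<close>

lemma edge_sphere_iff:
  assumes "y \<in> nbrs (universal_cover G x0) x" and "v \<in> cover_verts G x0"
  shows "{x, y} \<in> edge_sphere (universal_cover G x0) r v
           \<longleftrightarrow> min (prefix_dist x v) (prefix_dist y v) = r"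
proof -
  have xy: "x \<in> cover_verts G x0" "y \<in> cover_verts G x0" "{x, y} \<in> edges (universal_cover G x0)"
    using assms(1) by (auto simp: cover_nbrs_iff) (use assms(1) in \<open>auto simp: nbrs_def\<close>)
  have "{x, y} \<in> edge_sphere (universal_cover G x0) r v
      \<longleftrightarrow> min (graph_dist (universal_cover G x0) x v) (graph_dist (universal_cover G x0) y v) = r"
    using xy(3) by (auto simp: edge_sphere_def doubleton_eq_iff min.commute)
  then show ?thesis
    using xy assms(2) by (simp add: cover_graph_dist)
qed

lemma edge_sphere_radius_unique:
  "e \<in> edge_sphere T r v \<Longrightarrow> e \<in> edge_sphere T r' v \<Longrightarrow> r = r'"
  by (auto simp: edge_sphere_def doubleton_eq_iff min.commute)

text \<open>
  If going from \<open>w\<close> to \<open>w1\<close> leads towards the edge \<open>e\<close>, then going to any other neighbour leads away from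
  it. The nearer end \<open>x\<close> of \<open>e\<close> determines the direction; the other end \<open>y\<close> is at distance one from \<open>x\<close>, too
  close to lie on the side of \<open>w2\<close>.
\<close>

lemma edge_sphere_away:
  assumes w1: "w1 \<in> nbrs (universal_cover G x0) w" and w2: "w2 \<in> nbrs (universal_cover G x0) w"
    and "w1 \<noteq> w2"
    and near: "e \<in> edge_sphere (universal_cover G x0) r w1"
    and far: "e \<in> edge_sphere (universal_cover G x0) (Suc r) w"
  shows "e \<in> edge_sphere (universal_cover G x0) (Suc (Suc r)) w2"
proof -
  have cov: "w \<in> cover_verts G x0" "w1 \<in> cover_verts G x0" "w2 \<in> cover_verts G x0"
    using w1 w2 by (auto simp: cover_nbrs_iff)
  have "e \<in> edges (universal_cover G x0)" using near by (simp add: edge_sphere_def)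
  then obtain x y where e: "e = {x, y}" "y \<in> nbrs (universal_cover G x0) x"
      and le: "prefix_dist x w1 \<le> prefix_dist y w1"
    by (rule cover_edge_ends)
  have r: "prefix_dist x w1 = r"
    using near le cov e by (simp add: edge_sphere_iff)
  have Sr: "min (prefix_dist x w) (prefix_dist y w) = Suc r"
    using far cov e by (simp add: edge_sphere_iff)
  have step: "prefix_dist z w1 = Suc (prefix_dist z w) \<or> prefix_dist z w = Suc (prefix_dist z w1)"
    "prefix_dist z w2 = Suc (prefix_dist z w) \<or> prefix_dist z w = Suc (prefix_dist z w2)" for z
    using prefix_dist_step w1 w2 by metis+
  have side: "prefix_dist z w = Suc (prefix_dist z w1) \<Longrightarrow> prefix_dist z w2 = Suc (prefix_dist z w)"
    "prefix_dist z w = Suc (prefix_dist z w2) \<Longrightarrow> prefix_dist z w1 = Suc (prefix_dist z w)" for z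
    using prefix_dist_unique_closer assms(1-3) by metis+
  have xy: "prefix_dist y z = Suc (prefix_dist x z) \<or> prefix_dist x z = Suc (prefix_dist y z)" for z
    using prefix_dist_step[OF e(2), of z] by (simp add: prefix_dist_sym)
  have x: "prefix_dist x w = Suc r" "prefix_dist x w2 = Suc (Suc r)"
    using r Sr step(1)[of x] side(1)[of x] by auto
  have "prefix_dist y w \<noteq> Suc (prefix_dist y w2)"
    using side(2)[of y] xy[of w1] Sr r by auto
  then have "prefix_dist y w2 \<ge> Suc (Suc r)"
    using step(2)[of y] Sr by auto
  then have "min (prefix_dist x w2) (prefix_dist y w2) = Suc (Suc r)"
    using x by simp
  then show ?thesis using e cov by (simp add: edge_sphere_iff)
qed

lemma edge_sphere_closer:
  assumes "w \<in> cover_verts G x0" and "e \<in> edge_sphere (universal_cover G x0) (Suc r) w"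
  shows "\<exists>w'\<in>nbrs (universal_cover G x0) w. e \<in> edge_sphere (universal_cover G x0) r w'"
proof -
  have "e \<in> edges (universal_cover G x0)" using assms(2) by (simp add: edge_sphere_def)
  then obtain x y where e: "e = {x, y}" "y \<in> nbrs (universal_cover G x0) x"
      and le: "prefix_dist x w \<le> prefix_dist y w"
    by (rule cover_edge_ends)
  have Sr: "prefix_dist x w = Suc r"
    using assms le e by (simp add: edge_sphere_iff)
  have "x \<in> cover_verts G x0" using e(2) by (simp add: cover_nbrs_iff)
  moreover have "x \<noteq> w" using Sr by (metis nat.distinct(1) prefix_dist_eq_0)
  ultimately obtain w' where w': "w' \<in> nbrs (universal_cover G x0) w"
      "prefix_dist x w = Suc (prefix_dist x w')"
    using prefix_dist_closer_exists assms(1) by metis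
  have "min (prefix_dist x w') (prefix_dist y w') = r"
    using prefix_dist_step[OF w'(1), of y] w'(2) Sr le by auto
  moreover have "w' \<in> cover_verts G x0" using w'(1) by (simp add: cover_nbrs_iff)
  ultimately have "e \<in> edge_sphere (universal_cover G x0) r w'"
    using e by (simp add: edge_sphere_iff)
  then show ?thesis using w'(1) by blast
qed

text \<open>
  An edge beyond \<open>w\<close> is reached through a neighbour \<open>w''\<close> of \<open>w\<close>, and the condition on its distance from
  \<open>w'\<close> says exactly that this neighbour is not \<open>w'\<close>. Radius 1 is separate because
  an arc of radius 0 is not defined by spheres.
\<close>

lemma edge_arc_Suc:
  assumes w': "w' \<in> nbrs (universal_cover G x0) w"
  shows "edge_arc (universal_cover G x0) (Suc r) (w', w)
           = (\<Union>w''\<in>nbrs (universal_cover G x0) w - {w'}. edge_arc (universal_cover G x0) r (w, w''))"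
proof (cases r)
  case 0
  let ?T = "universal_cover G x0"
  have cov: "w \<in> cover_verts G x0" "w' \<in> cover_verts G x0"
    using w' by (auto simp: cover_nbrs_iff)
  have "e \<in> edge_sphere ?T (Suc 0) w' \<inter> edge_sphere ?T 0 w \<longleftrightarrow> (\<exists>w''\<in>nbrs ?T w - {w'}. e = {w, w''})" for e
  proof
    assume e: "e \<in> edge_sphere ?T (Suc 0) w' \<inter> edge_sphere ?T 0 w"
    then have "e \<in> edges ?T" by (simp add: edge_sphere_def)
    then obtain x y where xy: "e = {x, y}" "y \<in> nbrs ?T x"
      by (rule cover_edge_ends)
    then have "min (prefix_dist x w) (prefix_dist y w) = 0"
      and far: "min (prefix_dist x w') (prefix_dist y w') = Suc 0"
      using e cov by (simp_all add: edge_sphere_iff)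
    then have "x = w \<or> y = w" using prefix_dist_eq_0 by (metis min_def)
    moreover have "x \<noteq> w'" "y \<noteq> w'" using far prefix_dist_eq_0[of w' w'] by auto
    ultimately show "\<exists>w''\<in>nbrs ?T w - {w'}. e = {w, w''}"
      using xy nbrs_sym[of x ?T y] by auto
  next
    assume "\<exists>w''\<in>nbrs ?T w - {w'}. e = {w, w''}"
    then obtain w'' where w'': "w'' \<in> nbrs ?T w" "w'' \<noteq> w'" "e = {w, w''}" by blast
    have "prefix_dist w w = 0" "prefix_dist w'' w' \<noteq> 0"
      using w''(2) by (simp_all add: prefix_dist_eq_0)
    moreover have "prefix_dist w w' = 1"
      using prefix_dist_step[OF w', of w] \<open>prefix_dist w w = 0\<close> by simp
    ultimately show "e \<in> edge_sphere ?T (Suc 0) w' \<inter> edge_sphere ?T 0 w"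
      using w'' cov by (simp add: edge_sphere_iff)
  qed
  then show ?thesis using 0 by auto
next
  case (Suc k)
  let ?T = "universal_cover G x0"
  have cov: "w \<in> cover_verts G x0" "w' \<in> cover_verts G x0"
    using w' by (auto simp: cover_nbrs_iff)
  show ?thesis
  proof (intro equalityI subsetI)
    fix e assume "e \<in> edge_arc ?T (Suc r) (w', w)"
    then have e: "e \<in> edge_sphere ?T (Suc (Suc k)) w'" "e \<in> edge_sphere ?T (Suc k) w"
      using Suc by auto
    obtain w'' where w'': "w'' \<in> nbrs ?T w" "e \<in> edge_sphere ?T k w''"
      using edge_sphere_closer[OF cov(1) e(2)] by blast
    then have "w'' \<noteq> w'" using edge_sphere_radius_unique[OF e(1), of k] by auto
    then show "e \<in> (\<Union>w''\<in>nbrs ?T w - {w'}. edge_arc ?T r (w, w''))"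
      using w'' e Suc by auto
  next
    fix e assume "e \<in> (\<Union>w''\<in>nbrs ?T w - {w'}. edge_arc ?T r (w, w''))"
    then obtain w'' where w'': "w'' \<in> nbrs ?T w" "w'' \<noteq> w'" "e \<in> edge_sphere ?T k w''"
        "e \<in> edge_sphere ?T (Suc k) w"
      using Suc by auto
    then show "e \<in> edge_arc ?T (Suc r) (w', w)"
      using edge_sphere_away[OF w''(1) w' w''(2,3,4)] Suc by auto
  qed
qed

lemma edge_arc_disjoint:
  assumes w1: "w1 \<in> nbrs (universal_cover G x0) w" and w2: "w2 \<in> nbrs (universal_cover G x0) w"
    and "w1 \<noteq> w2"
  shows "edge_arc (universal_cover G x0) r (w, w1) \<inter> edge_arc (universal_cover G x0) r (w, w2) = {}"
proof (cases r)
  case 0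
  then show ?thesis using assms(3) by (auto simp: doubleton_eq_iff)
next
  case (Suc k)
  let ?T = "universal_cover G x0"
  have False if "e \<in> edge_sphere ?T k w1" "e \<in> edge_sphere ?T (Suc k) w" "e \<in> edge_sphere ?T k w2" for e
    using edge_sphere_radius_unique[OF edge_sphere_away[OF assms that(1,2)] that(3)] by simp
  then show ?thesis using Suc by auto
qed

section \<open>Arc averages as iterated averages over continuations\<close>

lemma cover_nbrs_project:
  assumes "w' \<in> nbrs (universal_cover G x0) w"
  shows "last w' \<in> nbrs G (last w)"
proof -
  obtain x where "w \<noteq> []" "w' \<noteq> []" "w' = w @ [x] \<and> w @ [x] \<in> cover_verts G x0
      \<or> w = w' @ [x] \<and> w' @ [x] \<in> cover_verts G x0"
    using assms cover_verts_not_Nil unfolding cover_nbrs_iff by metis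
  then show ?thesis
    using cover_verts_snocD(2)[of w x G x0] cover_verts_snocD(2)[of w' x G x0]
    by (auto simp: nbrs_def insert_commute)
qed

text \<open>
  The projection is a local isomorphism. Two neighbours of \<open>w\<close> could have the same end vertex only if an
  extension of \<open>w\<close> returned to the last vertex but one of \<open>w\<close>, and such an extension backtracks.
\<close>

lemma cover_nbrs_bij:
  assumes "simple_graph G" and "w \<in> cover_verts G x0"
  shows "bij_betw last (nbrs (universal_cover G x0) w) (nbrs G (last w))"
proof (rule bij_betw_imageI)
  have no_turn: False
    if w: "w = w2 @ [b]" "w @ [a] \<in> cover_verts G x0" and w2: "last w2 = a" "w2 \<noteq> []" for w2 a b
  proof -
    obtain us where "w2 = us @ [a]"
      using w2 by (cases w2 rule: rev_cases) auto
    then have "non_backtracking (us @ [a, b, a])"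
      using w by (simp add: cover_verts_def)
    then have "(us @ [a, b, a]) ! length us \<noteq> (us @ [a, b, a]) ! (length us + 2)"
      by (simp add: non_backtracking_def del: nth_append_length)
    then show False by (simp add: nth_append)
  qed
  show "inj_on last (nbrs (universal_cover G x0) w)"
  proof (rule inj_onI)
    fix w1 w2
    assume "w1 \<in> nbrs (universal_cover G x0) w" "w2 \<in> nbrs (universal_cover G x0) w" "last w1 = last w2"
    then show "w1 = w2"
      using no_turn cover_verts_not_Nil unfolding cover_nbrs_iff
      by (metis butlast_snoc last_snoc)
  qed
  show "last ` nbrs (universal_cover G x0) w = nbrs G (last w)"
  proof (intro equalityI subsetI)
    fix v assume "v \<in> last ` nbrs (universal_cover G x0) w"
    then show "v \<in> nbrs G (last w)"
      by (auto dest: cover_nbrs_project)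
  next
    fix v assume "v \<in> nbrs G (last w)"
    then show "v \<in> last ` nbrs (universal_cover G x0) w"
      using cover_step[OF assms, of v] by (force simp: nbrs_def)
  qed
qed

text \<open>One step of the non-backtracking walk on directed edges, as an averaging operator.\<close>

definition nb_avg :: "'a graph \<Rightarrow> ('a \<times> 'a \<Rightarrow> real) \<Rightarrow> 'a \<times> 'a \<Rightarrow> real" where
  "nb_avg G g = (\<lambda>(u, v). (\<Sum>w\<in>nbrs G v - {u}. g (v, w)) / real (card (nbrs G v - {u})))"

lemma nb_avg_apply:
  "nb_avg G g (u, v) = (\<Sum>w\<in>nbrs G v - {u}. g (v, w)) / real (card (nbrs G v - {u}))"
  by (simp add: nb_avg_def)

lemma card_nbrs:
  assumes "simple_graph G"
  shows "card (nbrs G v) = vertex_degree G v"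
  unfolding vertex_degree_def
proof (rule bij_betw_same_card[of "\<lambda>w. {v, w}"], rule bij_betw_imageI)
  show "inj_on (\<lambda>w. {v, w}) (nbrs G v)" by (auto simp: inj_on_def doubleton_eq_iff)
  show "(\<lambda>w. {v, w}) ` nbrs G v = {e \<in> edges G. v \<in> e}"
    using assms unfolding simple_graph_def nbrs_def by (fastforce simp: insert_commute)
qed

lemma semiregular_degree:
  assumes "semiregular G p q" and "w \<in> nbrs G v"
  shows "(card (nbrs G v) = p + 1 \<and> card (nbrs G w) = q + 1)
       \<or> (card (nbrs G v) = q + 1 \<and> card (nbrs G w) = p + 1)"
proof -
  have sg: "simple_graph G" using assms(1) by (simp add: semiregular_def)
  have "{v, w} \<in> edges G" using assms(2) by (simp add: nbrs_def)
  then obtain x y where "{v, w} = {x, y}" "vertex_degree G x = p + 1" "vertex_degree G y = q + 1"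
    using assms(1) unfolding semiregular_def by blast
  then show ?thesis by (auto simp: card_nbrs[OF sg] doubleton_eq_iff)
qed

lemma semiregular_degree_flip:
  assumes "semiregular G p q" and "w \<in> nbrs G v"
  shows "card (nbrs G w) = p + q + 2 - card (nbrs G v)"
  using semiregular_degree[OF assms] by auto

lemma cover_nbrs_finite:
  assumes "semiregular G p q" and "w' \<in> nbrs (universal_cover G x0) w"
  shows "finite (nbrs (universal_cover G x0) w)"
proof -
  have "bij_betw last (nbrs (universal_cover G x0) w) (nbrs G (last w))"
    using assms by (intro cover_nbrs_bij) (auto simp: cover_nbrs_iff semiregular_def)
  moreover from this have "last w' \<in> nbrs G (last w)"
    using assms(2) by (rule bij_betw_apply)
  then have "card (nbrs G (last w)) > 0"
    using semiregular_degree[OF assms(1)] by fastforce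
  ultimately have "card (nbrs (universal_cover G x0) w) > 0"
    by (simp add: bij_betw_same_card)
  then show ?thesis by (rule card_ge_0_finite)
qed

lemma edge_arc_finite:
  assumes "semiregular G p q" and "w' \<in> nbrs (universal_cover G x0) w"
  shows "finite (edge_arc (universal_cover G x0) r (w', w))"
  using assms(2)
proof (induction r arbitrary: w' w)
  case (Suc r)
  have "finite (edge_arc (universal_cover G x0) r (w, w''))"
    if "w'' \<in> nbrs (universal_cover G x0) w" for w''
    using that nbrs_sym[of w''] by (intro Suc.IH) simp
  then show ?case
    unfolding edge_arc_Suc[OF Suc.prems] using cover_nbrs_finite[OF assms(1) Suc.prems] by simp
qed simp

lemma sum_edge_arc_Suc:
  fixes h :: "'a list set \<Rightarrow> 'b::comm_monoid_add"
  assumes "semiregular G p q" and w': "w' \<in> nbrs (universal_cover G x0) w"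
  shows "(\<Sum>e\<in>edge_arc (universal_cover G x0) (Suc r) (w', w). h e)
       = (\<Sum>w''\<in>nbrs (universal_cover G x0) w - {w'}.
            \<Sum>e\<in>edge_arc (universal_cover G x0) r (w, w''). h e)"
  unfolding edge_arc_Suc[OF w']
proof (rule sum.UNION_disjoint)
  show "finite (nbrs (universal_cover G x0) w - {w'})"
    using cover_nbrs_finite[OF assms] by simp
  show "\<forall>w''\<in>nbrs (universal_cover G x0) w - {w'}. finite (edge_arc (universal_cover G x0) r (w, w''))"
    using nbrs_sym edge_arc_finite[OF assms(1)] by fast
qed (blast dest: edge_arc_disjoint)

text \<open>
  Degrees alternate between \<open>p + 1\<close> and \<open>q + 1\<close> along every path, so the branching of an arc is determined by
  the degree at which it starts. Arcs that continue the same edge thus have equal size, which lets the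
  arc average be taken in two stages with equal weights.
\<close>

lemma edge_arc_card:
  assumes sr: "semiregular G p q"
  shows "\<exists>K. \<forall>w' w. w' \<in> nbrs (universal_cover G x0) w \<longrightarrow>
           card (edge_arc (universal_cover G x0) r (w', w)) = K (card (nbrs G (last w)))"
proof (induction r)
  case 0
  then show ?case by (intro exI[of _ "\<lambda>_. 1"]) simp
next
  case (Suc r)
  let ?T = "universal_cover G x0"
  obtain K where K: "\<And>w' w. w' \<in> nbrs ?T w \<Longrightarrow> card (edge_arc ?T r (w', w)) = K (card (nbrs G (last w)))"
    using Suc by blast
  have "card (edge_arc ?T (Suc r) (w', w))
          = (card (nbrs G (last w)) - 1) * K (p + q + 2 - card (nbrs G (last w)))"
    if w': "w' \<in> nbrs ?T w" for w' w
  proof -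
    have bij: "bij_betw last (nbrs ?T w) (nbrs G (last w))"
      using w' sr by (intro cover_nbrs_bij) (auto simp: cover_nbrs_iff semiregular_def)
    have Kr: "card (edge_arc ?T r (w, w'')) = K (p + q + 2 - card (nbrs G (last w)))"
      if "w'' \<in> nbrs ?T w" for w''
    proof -
      have "card (nbrs G (last w'')) = p + q + 2 - card (nbrs G (last w))"
        using semiregular_degree_flip[OF sr] cover_nbrs_project[OF that] .
      then show ?thesis using K[of w w''] that nbrs_sym[of w''] by simp
    qed
    have "card (edge_arc ?T (Suc r) (w', w)) = (\<Sum>w''\<in>nbrs ?T w - {w'}. card (edge_arc ?T r (w, w'')))"
      using sum_edge_arc_Suc[OF sr w', where h = "\<lambda>_. 1::nat"] by simp
    then show ?thesis
      using Kr w' bij_betw_same_card[OF bij] by simp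
  qed
  then show ?case by (intro exI[of _ "\<lambda>d. (d - 1) * K (p + q + 2 - d)"]) blast
qed

lemma arc_average_Suc:
  assumes sr: "semiregular G p q" and w': "w' \<in> nbrs (universal_cover G x0) w"
  shows "arc_average G x0 (Suc r) (w', w) f
       = (\<Sum>w''\<in>nbrs (universal_cover G x0) w - {w'}. arc_average G x0 r (w, w'') f)
           / real (card (nbrs (universal_cover G x0) w - {w'}))"
proof -
  let ?T = "universal_cover G x0"
  obtain K where K: "\<And>w' w. w' \<in> nbrs ?T w \<Longrightarrow> card (edge_arc ?T r (w', w)) = K (card (nbrs G (last w)))"
    using edge_arc_card[OF sr] by blast
  define k where "k = K (p + q + 2 - card (nbrs G (last w)))"
  have Kr: "card (edge_arc ?T r (w, w'')) = k" if "w'' \<in> nbrs ?T w" for w''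
  proof -
    have "card (nbrs G (last w'')) = p + q + 2 - card (nbrs G (last w))"
      using semiregular_degree_flip[OF sr] cover_nbrs_project[OF that] .
    then show ?thesis using K[of w w''] that nbrs_sym[of w''] by (simp add: k_def)
  qed
  have "card (edge_arc ?T (Suc r) (w', w)) = card (nbrs ?T w - {w'}) * k"
    using sum_edge_arc_Suc[OF sr w', of "\<lambda>_. 1::nat"] Kr by simp
  then have "arc_average G x0 (Suc r) (w', w) f
      = (\<Sum>w''\<in>nbrs ?T w - {w'}. (\<Sum>e\<in>edge_arc ?T r (w, w''). lift f e) / real k)
          / real (card (nbrs ?T w - {w'}))"
    by (simp add: arc_average_def sum_edge_arc_Suc[OF sr w'] sum_divide_distrib mult.commute
          del: edge_arc.simps)
  also have "(\<Sum>w''\<in>nbrs ?T w - {w'}. (\<Sum>e\<in>edge_arc ?T r (w, w''). lift f e) / real k)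
      = (\<Sum>w''\<in>nbrs ?T w - {w'}. arc_average G x0 r (w, w'') f)"
    by (intro sum.cong) (simp_all add: arc_average_def Kr)
  finally show ?thesis .
qed

lemma arc_average_eq_iterate:
  assumes sr: "semiregular G p q" and "w' \<in> nbrs (universal_cover G x0) w"
  shows "arc_average G x0 r (w', w) f = (nb_avg G ^^ r) (\<lambda>(u, v). f {u, v}) (last w', last w)"
  using assms(2)
proof (induction r arbitrary: w' w)
  case 0
  then show ?case by (simp add: arc_average_def lift_def)
next
  case (Suc r)
  let ?T = "universal_cover G x0" and ?F = "(nb_avg G ^^ r) (\<lambda>(u, v). f {u, v})"
  have "bij_betw last (nbrs ?T w) (nbrs G (last w))"
    using Suc.prems sr by (intro cover_nbrs_bij) (auto simp: cover_nbrs_iff semiregular_def)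
  then have bij: "bij_betw last (nbrs ?T w - {w'}) (nbrs G (last w) - {last w'})"
    using Suc.prems by (auto simp: bij_betw_def inj_on_def)
  have "arc_average G x0 r (w, w'') f = ?F (last w, last w'')" if "w'' \<in> nbrs ?T w" for w''
    using that nbrs_sym[of w''] by (intro Suc.IH) simp
  then have "(\<Sum>w''\<in>nbrs ?T w - {w'}. arc_average G x0 r (w, w'') f)
      = (\<Sum>w''\<in>nbrs ?T w - {w'}. ?F (last w, last w''))"
    by (intro sum.cong) auto
  also have "\<dots> = (\<Sum>v\<in>nbrs G (last w) - {last w'}. ?F (last w, v))"
    using bij by (rule sum.reindex_bij_betw)
  finally have "(\<Sum>w''\<in>nbrs ?T w - {w'}. arc_average G x0 r (w, w'') f)
      = (\<Sum>v\<in>nbrs G (last w) - {last w'}. ?F (last w, v))" .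
  then show ?case
    using bij_betw_same_card[OF bij] by (simp add: arc_average_Suc[OF sr Suc.prems] nb_avg_apply)
qed

section \<open>Mixing of the non-backtracking averages\<close>

text \<open>
  With \<open>m\<close> the mean of \<open>h\<close>, the mean over all entries but \<open>u\<close> is \<open>m - (h u - m) / (d - 1)\<close>: the constant part is kept
  and the part of sum zero is multiplied by \<open>- 1 / (d - 1)\<close>. The loss in the sum of squares is therefore
  the factor \<open>1 - 1 / (d - 1)\<^sup>2 = d (d - 2) / (d - 1)\<^sup>2\<close> times the squared norm of the latter.
\<close>

lemma sum_squares_mean_of_others:
  fixes h :: "'b \<Rightarrow> real"
  assumes "finite N" and "card N \<ge> 2"
  defines "d \<equiv> real (card N)" and "m \<equiv> (\<Sum>w\<in>N. h w) / real (card N)"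
  shows "(\<Sum>u\<in>N. ((\<Sum>w\<in>N - {u}. h w) / real (card (N - {u})))\<^sup>2)
       = (\<Sum>u\<in>N. (h u)\<^sup>2) - d * (d - 2) / (d - 1)\<^sup>2 * (\<Sum>u\<in>N. (h u - m)\<^sup>2)"
proof -
  define k where "k u = h u - m" for u
  \<comment> \<open>The parts \<open>m\<close> and \<open>k\<close> are orthogonal; \<open>sq\<close> is used with \<open>b = 1 / (d - 1)\<close> and with \<open>b = - 1\<close>.\<close>
  have d: "d \<ge> 2" using assms(2) by (simp add: d_def)
  have s: "(\<Sum>w\<in>N. h w) = d * m" using d by (simp add: m_def d_def)
  then have k0: "(\<Sum>u\<in>N. k u) = 0" by (simp add: k_def sum_subtractf d_def)
  have sq: "(\<Sum>u\<in>N. (a - b * k u)\<^sup>2) = d * a\<^sup>2 + b\<^sup>2 * (\<Sum>u\<in>N. (k u)\<^sup>2)" for a b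
  proof -
    have "(\<Sum>u\<in>N. (a - b * k u)\<^sup>2) = (\<Sum>u\<in>N. a\<^sup>2 + b\<^sup>2 * (k u)\<^sup>2 - 2 * a * b * k u)"
      by (intro sum.cong) (auto simp: power2_eq_square algebra_simps)
    also have "\<dots> = d * a\<^sup>2 + b\<^sup>2 * (\<Sum>u\<in>N. (k u)\<^sup>2) - 2 * a * b * (\<Sum>u\<in>N. k u)"
      by (simp add: sum_subtractf sum.distrib sum_distrib_left d_def)
    finally show ?thesis by (simp add: k0)
  qed
  have "(\<Sum>w\<in>N - {u}. h w) / real (card (N - {u})) = m - 1 / (d - 1) * k u" if "u \<in> N" for u
  proof -
    have "(\<Sum>w\<in>N - {u}. h w) = d * m - h u"
      using that assms(1) s by (simp add: sum_diff1)
    moreover have "real (card (N - {u})) = d - 1"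
      using that assms(1) d by (simp add: d_def of_nat_diff)
    ultimately show ?thesis using d by (simp add: k_def divide_simps) (simp add: algebra_simps)
  qed
  then have "(\<Sum>u\<in>N. ((\<Sum>w\<in>N - {u}. h w) / real (card (N - {u})))\<^sup>2)
      = (\<Sum>u\<in>N. (m - 1 / (d - 1) * k u)\<^sup>2)"
    by simp
  also have "\<dots> = d * m\<^sup>2 + (1 / (d - 1))\<^sup>2 * (\<Sum>u\<in>N. (k u)\<^sup>2)"
    by (rule sq)
  also have "\<dots> = d * m\<^sup>2 + (\<Sum>u\<in>N. (k u)\<^sup>2) - d * (d - 2) / (d - 1)\<^sup>2 * (\<Sum>u\<in>N. (k u)\<^sup>2)"
  proof -
    have "d * (d - 2) = (d - 1)\<^sup>2 - 1" by (simp add: power2_eq_square algebra_simps)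
    then have "(1 / (d - 1))\<^sup>2 = 1 - d * (d - 2) / (d - 1)\<^sup>2"
      using d by (simp add: power_divide diff_divide_distrib)
    then show ?thesis by (simp only: left_diff_distrib)
  qed
  also have "d * m\<^sup>2 + (\<Sum>u\<in>N. (k u)\<^sup>2) = (\<Sum>u\<in>N. (m - (-1) * k u)\<^sup>2)"
    using sq[of m "-1"] by simp
  also have "\<dots> = (\<Sum>u\<in>N. (h u)\<^sup>2)" by (simp add: k_def)
  finally show ?thesis by (simp add: k_def)
qed

lemma sum_mean_of_others:
  fixes h :: "'b \<Rightarrow> real"
  assumes "finite N" and "card N \<ge> 2"
  shows "(\<Sum>u\<in>N. (\<Sum>w\<in>N - {u}. h w) / real (card (N - {u}))) = (\<Sum>u\<in>N. h u)"
proof -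
  have "(\<Sum>u\<in>N. (\<Sum>w\<in>N - {u}. h w) / real (card (N - {u})))
      = (\<Sum>u\<in>N. ((\<Sum>w\<in>N. h w) - h u) / (real (card N) - 1))"
    using assms by (intro sum.cong) (auto simp: sum_diff1 of_nat_diff)
  also have "\<dots> = (real (card N) * (\<Sum>w\<in>N. h w) - (\<Sum>u\<in>N. h u)) / (real (card N) - 1)"
    by (simp add: sum_subtractf flip: sum_divide_distrib)
  also have "\<dots> = (\<Sum>u\<in>N. h u)"
    using assms(2) by (simp add: field_simps)
  finally show ?thesis .
qed

text \<open>
  A continuous quadratic quantity that is pointwise smaller than the squared norm on a closed cone is
  smaller by a fixed factor: it attains its maximum on the unit sphere of the cone. The sphere
  is compact because functions in \<open>W\<close> live on the finite set \<open>S\<close>, which places it in a cube.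
\<close>

lemma strict_contraction_uniform:
  fixes Q :: "('b \<Rightarrow> real) \<Rightarrow> real"
  assumes "finite S" and "closed W" and contQ: "continuous_on UNIV Q"
    and homQ: "\<And>c g. Q (\<lambda>x. c * g x) = c\<^sup>2 * Q g"
    and cone: "\<And>c g. g \<in> W \<Longrightarrow> (\<lambda>x. c * g x) \<in> W"
    and supp: "\<And>g x. g \<in> W \<Longrightarrow> x \<notin> S \<Longrightarrow> g x = 0"
    and strict: "\<And>g. g \<in> W \<Longrightarrow> (\<Sum>x\<in>S. (g x)\<^sup>2) \<noteq> 0 \<Longrightarrow> Q g < (\<Sum>x\<in>S. (g x)\<^sup>2)"
  obtains \<rho> where "\<rho> < 1" "\<And>g. g \<in> W \<Longrightarrow> Q g \<le> \<rho> * (\<Sum>x\<in>S. (g x)\<^sup>2)"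
proof -
  define E where "E g = (\<Sum>x\<in>S. (g x)\<^sup>2)" for g :: "'b \<Rightarrow> real"
  define U where "U = (W \<inter> {g. E g = 1})"
  have contE: "continuous_on UNIV E"
    unfolding E_def by (intro continuous_intros continuous_on_product_coordinates)
  have "U \<subseteq> PiE UNIV (\<lambda>_. {-1..1})"
  proof
    fix g assume g: "g \<in> U"
    have "\<bar>g x\<bar> \<le> 1" for x
    proof (cases "x \<in> S")
      case True
      then have "(g x)\<^sup>2 \<le> E g"
        unfolding E_def using assms(1) by (intro member_le_sum) auto
      then show ?thesis using g by (simp add: U_def abs_square_le_1)
    qed (use g supp[of g] in \<open>simp add: U_def\<close>)
    then have "g x \<in> {-1..1}" for x
      unfolding atLeastAtMost_iff by (metis abs_le_iff minus_le_iff)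
    then show "g \<in> PiE UNIV (\<lambda>_. {-1..1})" by blast
  qed
  moreover have "compact (PiE UNIV (\<lambda>_::'b. {-1..1::real}))"
  proof -
    have "compactin (product_topology (\<lambda>_. euclidean) UNIV) (PiE UNIV (\<lambda>_::'b. {-1..1::real}))"
      by (simp add: compactin_PiE)
    then show ?thesis by (simp add: euclidean_product_topology)
  qed
  moreover have "closed U"
    unfolding U_def using assms(2) contE by (intro closed_Int closed_Collect_eq continuous_on_const) auto
  ultimately have cptU: "compact U"
    by (metis compact_Int_closed inf.absorb2)
  have zero: "Q g \<le> \<rho> * E g" if "g \<in> W" "E g = 0" for g \<rho>
  proof -
    have "g x = 0" for x
      using that supp[OF that(1), of x] assms(1) by (cases "x \<in> S") (auto simp: E_def sum_nonneg_eq_0_iff)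
    then have "g = (\<lambda>x. 0 * g x)" by auto
    then have "Q g = 0" using homQ[of 0 g] by simp
    then show ?thesis using that(2) by simp
  qed
  have norm: "(\<lambda>x. (1 / sqrt (E g)) * g x) \<in> U" "Q g = E g * Q (\<lambda>x. (1 / sqrt (E g)) * g x)"
    if "g \<in> W" "E g \<noteq> 0" for g
  proof -
    have "E g > 0" using that(2) by (simp add: E_def order_le_neq_trans sum_nonneg)
    moreover have "E (\<lambda>x. (1 / sqrt (E g)) * g x) = (1 / sqrt (E g))\<^sup>2 * E g"
      unfolding E_def by (simp only: power_mult_distrib sum_distrib_left)
    ultimately show "(\<lambda>x. (1 / sqrt (E g)) * g x) \<in> U" "Q g = E g * Q (\<lambda>x. (1 / sqrt (E g)) * g x)"
      using cone[OF that(1), of "1 / sqrt (E g)"] homQ[of "1 / sqrt (E g)" g]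
      by (simp_all add: U_def power_divide)
  qed
  have nonneg: "E g \<ge> 0" for g by (simp add: E_def sum_nonneg)
  show thesis
  proof (cases "U = {}")
    case True
    \<comment> \<open>An empty sphere leaves only functions of norm zero, for which any factor will do.\<close>
    then have "Q g \<le> 0 * E g" if "g \<in> W" for g
      using zero norm(1) that by blast
    then show thesis using that[of 0] by (simp add: E_def)
  next
    case False
    have "continuous_on U Q" using contQ continuous_on_subset by blast
    then obtain g0 where g0: "g0 \<in> U" "\<And>g. g \<in> U \<Longrightarrow> Q g \<le> Q g0"
      using continuous_attains_sup[OF cptU False] by blast
    have "Q g0 < 1" using g0(1) strict[of g0] by (simp add: U_def E_def)
    moreover have "Q g \<le> Q g0 * E g" if "g \<in> W" for g
    proof (cases "E g = 0")
      case False
      then have "Q g \<le> E g * Q g0"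
        using norm[OF that] g0(2) nonneg by (metis mult_left_mono)
      then show ?thesis by (simp add: mult.commute)
    qed (use zero that in blast)
    ultimately show thesis using that[of "Q g0"] by (simp add: E_def)
  qed
qed

text \<open>The squared Euclidean norm on directed edges.\<close>

definition energy :: "'a graph \<Rightarrow> ('a \<times> 'a \<Rightarrow> real) \<Rightarrow> real" where
  "energy G g = (\<Sum>v\<in>verts G. \<Sum>w\<in>nbrs G v. (g (v, w))\<^sup>2)"

lemma nb_avg_cong:
  assumes "\<And>v w. w \<in> nbrs G v \<Longrightarrow> g (v, w) = h (v, w)"
  shows "nb_avg G g = nb_avg G h"
  unfolding nb_avg_def using assms by (intro ext) (auto intro!: sum.cong arg_cong2[where f = "(/)"])

text \<open>
  The mixing argument works for any finite connected bipartite graph in which each vertex that has a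
  neighbour has at least three of them. Isolated vertices have to be admitted because the graph with one
  vertex and no edge is semiregular.
\<close>

locale branching_bipartite_graph =
  fixes G :: "'a graph" and A B :: "'a set"
  assumes finite_verts: "finite (verts G)"
    and connected: "connected_graph G"
    and parts: "A \<union> B = verts G" "A \<inter> B = {}"
    and bipartite: "\<And>e. e \<in> edges G \<Longrightarrow> \<exists>a\<in>A. \<exists>b\<in>B. e = {a, b}"
    and branching: "\<And>v. nbrs G v \<noteq> {} \<Longrightarrow> 3 \<le> card (nbrs G v)"
begin

text \<open>
  Functions orthogonal to the indicators of the two classes of directed edges, those from \<open>A\<close> to \<open>B\<close>
  and those from \<open>B\<close> to \<open>A\<close>. The walk alternates between the classes, so on functions that are orthogonal only to
  the constants it would not mix.
\<close>

abbreviation balanced :: "('a \<times> 'a \<Rightarrow> real) \<Rightarrow> bool" where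
  "balanced g \<equiv> (\<Sum>u\<in>A. \<Sum>v\<in>nbrs G u. g (u, v)) = 0 \<and> (\<Sum>u\<in>B. \<Sum>v\<in>nbrs G u. g (u, v)) = 0"

lemma parts_swap: "branching_bipartite_graph G B A"
proof
  show "\<exists>a\<in>B. \<exists>b\<in>A. e = {a, b}" if "e \<in> edges G" for e
    using bipartite[OF that] by (metis insert_commute)
qed (use finite_verts connected parts branching in auto)

lemma finite_parts: "finite A" "finite B"
  using finite_verts parts by (metis finite_Un)+

lemma nbrs_part: "v \<in> nbrs G u \<Longrightarrow> u \<in> A \<and> v \<in> B \<or> u \<in> B \<and> v \<in> A"
  using bipartite[of "{u, v}"] by (auto simp: nbrs_def doubleton_eq_iff)

lemma finite_nbrs: "finite (nbrs G v)"
  by (rule finite_subset[of _ "verts G"]) (use nbrs_part parts finite_verts in auto)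

lemma sum_arcs_flip:
  "(\<Sum>u\<in>A. \<Sum>v\<in>nbrs G u. F u v) = (\<Sum>v\<in>B. \<Sum>u\<in>nbrs G v. (F u v :: real))"
proof -
  have "nbrs G u = {v \<in> B. v \<in> nbrs G u}" if "u \<in> A" for u
    using that nbrs_part parts by blast
  moreover have "nbrs G v = {u \<in> A. v \<in> nbrs G u}" if "v \<in> B" for v
    using that nbrs_part parts nbrs_sym by fast
  ultimately show ?thesis
    using sum.swap_restrict[OF finite_parts, of F "\<lambda>u v. v \<in> nbrs G u"] by (simp cong: sum.cong)
qed

lemma sum_verts: "(\<Sum>v\<in>verts G. F v) = (\<Sum>v\<in>A. F v) + (\<Sum>v\<in>B. (F v :: real))"
  using parts finite_parts by (metis sum.union_disjoint)

text \<open>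
  A step of the walk mixes the values on the edges leaving \<open>v\<close> into the values on the edges
  entering \<open>v\<close>. To compare norms vertex by vertex, the norm of the image has to be
  grouped by end vertex instead of initial vertex.
\<close>

lemma energy_flip: "energy G g = (\<Sum>v\<in>verts G. \<Sum>u\<in>nbrs G v. (g (u, v))\<^sup>2)"
proof -
  interpret swap: branching_bipartite_graph G B A by (rule parts_swap)
  show ?thesis
    using sum_arcs_flip[of "\<lambda>u v. (g (u, v))\<^sup>2"] swap.sum_arcs_flip[of "\<lambda>u v. (g (u, v))\<^sup>2"]
    by (simp add: energy_def sum_verts)
qed

lemma sum_nb_avg_squares_le:
  "(\<Sum>u\<in>nbrs G v. (nb_avg G g (u, v))\<^sup>2) \<le> (\<Sum>w\<in>nbrs G v. (g (v, w))\<^sup>2)"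
  "(\<Sum>u\<in>nbrs G v. (nb_avg G g (u, v))\<^sup>2) = (\<Sum>w\<in>nbrs G v. (g (v, w))\<^sup>2) \<Longrightarrow>
     x \<in> nbrs G v \<Longrightarrow> y \<in> nbrs G v \<Longrightarrow> g (v, x) = g (v, y)"
proof -
  define d where "d = real (card (nbrs G v))"
  define m where "m = (\<Sum>w\<in>nbrs G v. g (v, w)) / d"
  define c where "c = d * (d - 2) / (d - 1)\<^sup>2"
  have eq: "(\<Sum>u\<in>nbrs G v. (nb_avg G g (u, v))\<^sup>2)
      = (\<Sum>w\<in>nbrs G v. (g (v, w))\<^sup>2) - c * (\<Sum>w\<in>nbrs G v. (g (v, w) - m)\<^sup>2)"
    and c: "c > 0" if "nbrs G v \<noteq> {}"
    using sum_squares_mean_of_others[OF finite_nbrs, of v "\<lambda>w. g (v, w)"] branching[OF that]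
    by (simp_all add: nb_avg_def d_def m_def c_def)
  show "(\<Sum>u\<in>nbrs G v. (nb_avg G g (u, v))\<^sup>2) \<le> (\<Sum>w\<in>nbrs G v. (g (v, w))\<^sup>2)"
    using eq c by (cases "nbrs G v = {}") (auto intro!: mult_nonneg_nonneg sum_nonneg)
  assume "(\<Sum>u\<in>nbrs G v. (nb_avg G g (u, v))\<^sup>2) = (\<Sum>w\<in>nbrs G v. (g (v, w))\<^sup>2)"
    and xy: "x \<in> nbrs G v" "y \<in> nbrs G v"
  moreover from xy have "nbrs G v \<noteq> {}" by auto
  ultimately have "(\<Sum>w\<in>nbrs G v. (g (v, w) - m)\<^sup>2) = 0"
    using eq c by simp
  then have "\<forall>w\<in>nbrs G v. g (v, w) - m = 0"
    by (simp add: sum_nonneg_eq_0_iff finite_nbrs)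
  then show "g (v, x) = g (v, y)" using xy by simp
qed

lemma energy_nb_avg_le: "energy G (nb_avg G g) \<le> energy G g"
  unfolding energy_flip[of "nb_avg G g"] unfolding energy_def
  by (intro sum_mono sum_nb_avg_squares_le(1))

lemma energy_nb_avg_eqD:
  assumes "energy G (nb_avg G g) = energy G g" and "x \<in> nbrs G v" and "y \<in> nbrs G v"
  shows "g (v, x) = g (v, y)"
proof (rule sum_nb_avg_squares_le(2)[OF _ assms(2,3)])
  have "v \<in> verts G" using assms(2) nbrs_part parts by blast
  then show "(\<Sum>u\<in>nbrs G v. (nb_avg G g (u, v))\<^sup>2) = (\<Sum>w\<in>nbrs G v. (g (v, w))\<^sup>2)"
    using assms(1) finite_verts
    unfolding energy_flip[of "nb_avg G g"] unfolding energy_def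
    by (rule_tac sum_mono_inv) (auto intro: sum_nb_avg_squares_le(1))
qed

text \<open>
  An edge leaving \<open>v\<close> continues \<open>d - 1\<close> of the edges entering \<open>v\<close>, each time with weight \<open>1 / (d - 1)\<close>.
  So the values on the edges entering \<open>v\<close> after a step have the same sum as those on the edges leaving
  \<open>v\<close> before it, and the step exchanges the two sums.
\<close>

lemma balanced_nb_avg:
  assumes "balanced g"
  shows "balanced (nb_avg G g)"
proof -
  interpret swap: branching_bipartite_graph G B A by (rule parts_swap)
  have "(\<Sum>u\<in>nbrs G v. nb_avg G g (u, v)) = (\<Sum>w\<in>nbrs G v. g (v, w))" for v
    using sum_mean_of_others[OF finite_nbrs, of v "\<lambda>w. g (v, w)"] branching[of v]
    by (cases "nbrs G v = {}") (auto simp: nb_avg_def)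
  then show ?thesis
    using assms sum_arcs_flip[of "\<lambda>u v. nb_avg G g (u, v)"]
      swap.sum_arcs_flip[of "\<lambda>u v. nb_avg G g (u, v)"] by simp
qed

lemma edge_invariant_constant:
  assumes edge: "\<And>u v. v \<in> nbrs G u \<Longrightarrow> \<phi> u = \<phi> v" and "u \<in> verts G" and "v \<in> verts G"
  shows "\<phi> u = \<phi> v"
proof -
  have "\<phi> (hd xs) = \<phi> (last xs)" if "walk G xs" for xs
    using that
  proof (induction xs rule: rev_induct)
    case (snoc x xs)
    show ?case
    proof (cases "xs = []")
      case False
      then have "\<phi> (last xs) = \<phi> x"
        using walk_snocD(2)[OF snoc.prems] by (intro edge) (simp add: nbrs_def)
      then show ?thesis
        using False snoc.IH[OF walk_snocD(1)[OF snoc.prems False]] by simp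
    qed simp
  qed (simp add: walk_def)
  then show ?thesis
    using connected assms(2,3) unfolding connected_graph_def by metis
qed

text \<open>
  Norm preservation in the first step makes \<open>g\<close> constant on the edges leaving each vertex \<open>v\<close>, so that
  averaging only reverses edges: on an edge from \<open>u\<close> to \<open>v\<close>, \<open>P g\<close> is the value of \<open>g\<close> on the edge
  from \<open>v\<close> to \<open>u\<close>. Norm preservation in the second step makes \<open>P g\<close>, too, constant on the edges leaving
  each vertex. The function \<open>\<phi>\<close> takes the value of \<open>g\<close> on the edges leaving a vertex of \<open>A\<close> and the value
  of \<open>P g\<close> on those leaving a vertex of \<open>B\<close>; it does not change along edges, so connectedness makes it
  constant.
\<close>

lemma energy_two_steps_eqD:
  assumes eq: "energy G (nb_avg G (nb_avg G g)) = energy G g"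
    and sum0: "(\<Sum>u\<in>A. \<Sum>v\<in>nbrs G u. g (u, v)) = 0"
    and a0: "a0 \<in> A" "b0 \<in> nbrs G a0"
  shows "g (a0, b0) = 0"
proof -
  let ?P = "nb_avg G g"
  have "energy G (nb_avg G ?P) = energy G ?P" "energy G ?P = energy G g"
    using eq energy_nb_avg_le[of g] energy_nb_avg_le[of ?P] by linarith+
  then have g: "g (v, x) = g (v, y)" and P: "?P (v, x) = ?P (v, y)"
    if "x \<in> nbrs G v" "y \<in> nbrs G v" for v x y
    using energy_nb_avg_eqD that by blast+
  have step: "?P (u, v) = g (v, u)" if "u \<in> nbrs G v" for u v
  proof -
    have "card (nbrs G v) \<ge> 3" using branching[of v] that by auto
    then have "card (nbrs G v - {u}) > 0" using that finite_nbrs by simp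
    moreover have "(\<Sum>w\<in>nbrs G v - {u}. g (v, w)) = (\<Sum>w\<in>nbrs G v - {u}. g (v, u))"
      using g[OF _ that] by (intro sum.cong) blast+
    ultimately show ?thesis by (simp add: nb_avg_def)
  qed
  \<comment> \<open>The chosen neighbour does not matter, because \<open>g\<close> and \<open>P g\<close> are constant on the edges leaving \<open>v\<close>.\<close>
  define \<phi> where "\<phi> v = (if v \<in> A then g (v, SOME w. w \<in> nbrs G v) else ?P (v, SOME w. w \<in> nbrs G v))" for v
  have some: "(SOME x. x \<in> nbrs G v) \<in> nbrs G v" if "w \<in> nbrs G v" for v w
    using that by (rule someI)
  have \<phi>A: "\<phi> v = g (v, w)" if "v \<in> A" "w \<in> nbrs G v" for v w
    using that g[OF some[OF that(2)] that(2)] by (simp add: \<phi>_def)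
  have \<phi>B: "\<phi> v = ?P (v, w)" if "v \<in> B" "w \<in> nbrs G v" for v w
    using that P[OF some[OF that(2)] that(2)] parts by (auto simp: \<phi>_def)
  have AB: "\<phi> a = \<phi> b" if "a \<in> A" "b \<in> B" "b \<in> nbrs G a" for a b
    using \<phi>A[OF that(1,3)] \<phi>B[OF that(2), of a] step[of b a] that nbrs_sym[of a] by simp
  have "\<phi> u = \<phi> v" if "u \<in> verts G" "v \<in> verts G" for u v
  proof (rule edge_invariant_constant[OF _ that])
    show "\<phi> x = \<phi> y" if "y \<in> nbrs G x" for x y
      using nbrs_part[OF that] AB[of x y] AB[of y x] that nbrs_sym[of y _ x] by auto
  qed
  then have const: "g (a, b) = g (a0, b0)" if "a \<in> A" "b \<in> nbrs G a" for a b
    using \<phi>A[OF that] \<phi>A[OF a0] that a0 parts by (metis UnI1)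
  have "0 = (\<Sum>u\<in>A. \<Sum>v\<in>nbrs G u. g (a0, b0))"
    unfolding sum0[symmetric] using const by (intro sum.cong) auto
  also have "\<dots> = real (\<Sum>u\<in>A. card (nbrs G u)) * g (a0, b0)"
    by (simp add: sum_distrib_right)
  finally have "real (\<Sum>u\<in>A. card (nbrs G u)) * g (a0, b0) = 0" by simp
  moreover have "(\<Sum>u\<in>A. card (nbrs G u)) \<noteq> 0"
    using a0 finite_parts finite_nbrs by auto
  ultimately show ?thesis by (metis mult_eq_0_iff of_nat_eq_0_iff)
qed

lemma energy_two_steps_strict:
  assumes "balanced g" and "energy G g \<noteq> 0"
  shows "energy G (nb_avg G (nb_avg G g)) < energy G g"
proof (rule ccontr)
  interpret swap: branching_bipartite_graph G B A by (rule parts_swap)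
  assume "\<not> ?thesis"
  then have eq: "energy G (nb_avg G (nb_avg G g)) = energy G g"
    using energy_nb_avg_le[of g] energy_nb_avg_le[of "nb_avg G g"] by linarith
  have "g (u, v) = 0" if "v \<in> nbrs G u" for u v
    using nbrs_part[OF that] energy_two_steps_eqD[OF eq _ _ that]
      swap.energy_two_steps_eqD[OF eq _ _ that] assms(1) by blast
  then have "energy G g = 0" by (simp add: energy_def)
  then show False using assms(2) by simp
qed

text \<open>
  The compactness argument needs functions supported on the finite set of directed edges. Setting a
  function to zero elsewhere is harmless, since the operator and the energy only read its values
  there.
\<close>

lemma energy_two_steps_uniform:
  obtains \<rho> where "\<rho> < 1" "\<And>g. balanced g \<Longrightarrow> energy G (nb_avg G (nb_avg G g)) \<le> \<rho> * energy G g"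
proof -
  define S where "S = (SIGMA v:verts G. nbrs G v)"
  define W where "W = {g. (\<forall>x. x \<notin> S \<longrightarrow> g x = 0) \<and> balanced g}"
  define Q where "Q g = energy G (nb_avg G (nb_avg G g))" for g
  have S: "(v, w) \<in> S \<longleftrightarrow> w \<in> nbrs G v" for v w
    using nbrs_part parts by (auto simp: S_def)
  have E: "energy G g = (\<Sum>x\<in>S. (g x)\<^sup>2)" for g
    unfolding energy_def S_def using finite_verts finite_nbrs by (subst sum.Sigma) auto
  have avg_cont: "continuous_on UNIV (\<lambda>g. nb_avg G (h g) x)"
    if "\<And>y. continuous_on UNIV (\<lambda>g. h g y)" for h :: "('a \<times> 'a \<Rightarrow> real) \<Rightarrow> _" and x
    using that by (cases x) (auto simp: nb_avg_def divide_inverse intro!: continuous_intros)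
  have avg_scale: "nb_avg G (\<lambda>x. c * g x) = (\<lambda>x. c * nb_avg G g x)" for c g
    by (auto simp: nb_avg_def fun_eq_iff sum_distrib_left)
  obtain \<rho> where \<rho>: "\<rho> < 1" "\<And>g. g \<in> W \<Longrightarrow> Q g \<le> \<rho> * (\<Sum>x\<in>S. (g x)\<^sup>2)"
  proof (rule strict_contraction_uniform)
    show "finite S" unfolding S_def using finite_verts finite_nbrs by blast
    show "closed W"
      unfolding W_def
      by (intro closed_Collect_conj closed_Collect_all closed_Collect_imp open_Collect_const
          closed_Collect_eq continuous_intros continuous_on_product_coordinates)
    show "continuous_on UNIV Q"
      unfolding Q_def energy_def by (intro continuous_intros avg_cont continuous_on_product_coordinates)
    show "Q (\<lambda>x. c * g x) = c\<^sup>2 * Q g" for c g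
      by (simp add: Q_def avg_scale energy_def power_mult_distrib sum_distrib_left)
    show "(\<lambda>x. c * g x) \<in> W" if "g \<in> W" for c g
      using that by (simp add: W_def flip: sum_distrib_left)
    show "g x = 0" if "g \<in> W" "x \<notin> S" for g x
      using that by (cases x) (simp add: W_def)
    show "Q g < (\<Sum>x\<in>S. (g x)\<^sup>2)" if "g \<in> W" "(\<Sum>x\<in>S. (g x)\<^sup>2) \<noteq> 0" for g
      using that energy_two_steps_strict[of g] by (simp add: W_def Q_def E)
  qed (use that in blast)
  have "energy G (nb_avg G (nb_avg G g)) \<le> \<rho> * energy G g" if "balanced g" for g
  proof -
    define h where "h x = (if x \<in> S then g x else 0)" for x
    have h: "h (v, w) = g (v, w)" if "w \<in> nbrs G v" for v w
      using that by (simp add: h_def S)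
    then have "h \<in> W"
      using that by (auto simp: W_def h_def)
    moreover have "nb_avg G h = nb_avg G g" using h by (rule nb_avg_cong)
    moreover have "energy G h = energy G g" using h by (simp add: energy_def)
    ultimately show ?thesis using \<rho>(2)[of h] by (simp add: Q_def E)
  qed
  then show thesis using that \<rho>(1) by blast
qed

text \<open>
  Only pairs of steps are known to contract, whence the exponent \<open>r div 2\<close>; a single remaining step does
  not increase the energy.
\<close>

lemma energy_iterate_decay:
  obtains \<rho> where "0 \<le> \<rho>" "\<rho> < 1"
    "\<And>g r. balanced g \<Longrightarrow> energy G ((nb_avg G ^^ r) g) \<le> \<rho> ^ (r div 2) * energy G g"
proof -
  obtain \<rho>' where \<rho>': "\<rho>' < 1"
    "\<And>g. balanced g \<Longrightarrow> energy G (nb_avg G (nb_avg G g)) \<le> \<rho>' * energy G g"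
    using energy_two_steps_uniform by blast
  \<comment> \<open>The factor found by compactness may be negative if all energies vanish; powers need a nonnegative one.\<close>
  define \<rho> where "\<rho> = max \<rho>' 0"
  have E0: "energy G g \<ge> 0" for g by (simp add: energy_def sum_nonneg)
  have two: "energy G (nb_avg G (nb_avg G g)) \<le> \<rho> * energy G g" if "balanced g" for g
    using \<rho>'(2)[OF that] E0[of g] mult_right_mono[of \<rho>' \<rho> "energy G g"] by (simp add: \<rho>_def)
  have bal: "balanced ((nb_avg G ^^ r) g)" if "balanced g" for g r
    using that by (induction r) (auto simp only: funpow.simps comp_def id_def intro!: balanced_nb_avg)
  have "energy G ((nb_avg G ^^ r) g) \<le> \<rho> ^ (r div 2) * energy G g" if "balanced g" for g r
  proof (induction r rule: nat_induct2)
    case 1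
    then show ?case using energy_nb_avg_le[of g] by simp
  next
    case (step r)
    have "energy G ((nb_avg G ^^ (r + 2)) g) \<le> \<rho> * energy G ((nb_avg G ^^ r) g)"
      using two[OF bal[OF that, of r]] by simp
    also have "\<dots> \<le> \<rho> * (\<rho> ^ (r div 2) * energy G g)"
      using step by (intro mult_left_mono) (simp_all add: \<rho>_def)
    finally show ?case by (simp add: mult.assoc)
  qed simp
  then show thesis using that[of \<rho>] \<rho>'(1) by (simp add: \<rho>_def)
qed

lemma sum_arcs_eq_sum_edges:
  "(\<Sum>u\<in>A. \<Sum>v\<in>nbrs G u. F {u, v}) = (\<Sum>e\<in>edges G. (F e :: real))"
proof -
  have "(\<Sum>u\<in>A. \<Sum>v\<in>nbrs G u. F {u, v}) = (\<Sum>a\<in>(SIGMA u:A. nbrs G u). F (case a of (u, v) \<Rightarrow> {u, v}))"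
    using finite_parts finite_nbrs by (subst sum.Sigma) (auto intro!: sum.cong)
  also have "\<dots> = (\<Sum>e\<in>edges G. F e)"
  proof (rule sum.reindex_bij_betw, rule bij_betw_imageI)
    show "inj_on (\<lambda>(u, v). {u, v}) (SIGMA u:A. nbrs G u)"
      using nbrs_part parts by (fastforce simp: inj_on_def doubleton_eq_iff)
    show "(\<lambda>(u, v). {u, v}) ` (SIGMA u:A. nbrs G u) = edges G"
      using bipartite by (fastforce simp: nbrs_def image_iff)
  qed
  finally show ?thesis .
qed

lemma nb_avg_iterate_diff_const:
  "v \<in> nbrs G u \<Longrightarrow> (nb_avg G ^^ r) (\<lambda>x. g x - c) (u, v) = (nb_avg G ^^ r) g (u, v) - c"
proof (induction r arbitrary: u v)
  case (Suc r)
  let ?N = "nbrs G v - {u}"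
  have u: "u \<in> nbrs G v" using Suc.prems nbrs_sym by metis
  then have "card (nbrs G v) \<ge> 3" using branching[of v] by blast
  then have "card ?N > 0" using u finite_nbrs[of v] by simp
  moreover have "(\<Sum>w\<in>?N. (nb_avg G ^^ r) (\<lambda>x. g x - c) (v, w)) = (\<Sum>w\<in>?N. (nb_avg G ^^ r) g (v, w) - c)"
    using Suc.IH by (intro sum.cong) auto
  ultimately show ?case
    by (simp add: nb_avg_apply sum_subtractf diff_divide_distrib)
qed simp

lemma square_le_energy:
  assumes "v \<in> nbrs G u"
  shows "(g (u, v))\<^sup>2 \<le> energy G g"
proof -
  have "(g (u, v))\<^sup>2 \<le> (\<Sum>w\<in>nbrs G u. (g (u, w))\<^sup>2)"
    using assms finite_nbrs by (intro member_le_sum) auto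
  also have "\<dots> \<le> energy G g"
    unfolding energy_def using nbrs_part[OF assms] parts finite_verts
    by (intro member_le_sum[where f = "\<lambda>u. \<Sum>w\<in>nbrs G u. (g (u, w))\<^sup>2"]) (auto intro: sum_nonneg)
  finally show ?thesis .
qed

text \<open>
  Each undirected edge is crossed once in either direction, so a function of undirected edges with sum
  zero has sum zero over both classes of directed edges. Subtracting the mean does not increase the
  norm; the factor 2 counts the two directions.
\<close>

lemma centred_edge_function:
  fixes f :: "'a set \<Rightarrow> real"
  defines "c \<equiv> (\<Sum>e\<in>edges G. f e) / real (card (edges G))"
  defines "g \<equiv> \<lambda>x. (case x of (u, v) \<Rightarrow> f {u, v}) - c"
  shows "balanced g" "energy G g \<le> 2 * (edge_norm G f)\<^sup>2"
proof -
  interpret swap: branching_bipartite_graph G B A by (rule parts_swap)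
  have total: "(\<Sum>e\<in>edges G. f e) = real (card (edges G)) * c"
    by (cases "card (edges G) = 0") (auto simp: c_def card_eq_0_iff)
  then have "(\<Sum>e\<in>edges G. f e - c) = 0"
    by (simp add: sum_subtractf)
  then show "balanced g"
    using sum_arcs_eq_sum_edges[of "\<lambda>e. f e - c"] swap.sum_arcs_eq_sum_edges[of "\<lambda>e. f e - c"]
    by (simp add: g_def)
  have "energy G g = 2 * (\<Sum>e\<in>edges G. (f e - c)\<^sup>2)"
    using sum_arcs_eq_sum_edges[of "\<lambda>e. (f e - c)\<^sup>2"] swap.sum_arcs_eq_sum_edges[of "\<lambda>e. (f e - c)\<^sup>2"]
    by (simp add: energy_def sum_verts g_def)
  also have "(\<Sum>e\<in>edges G. (f e - c)\<^sup>2) = (\<Sum>e\<in>edges G. f e * f e + c\<^sup>2 - 2 * c * f e)"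
    by (intro sum.cong) (auto simp: power2_eq_square algebra_simps)
  also have "\<dots> = (\<Sum>e\<in>edges G. f e * f e) + real (card (edges G)) * c\<^sup>2 - 2 * c * (\<Sum>e\<in>edges G. f e)"
    by (simp add: sum_subtractf sum.distrib sum_distrib_left)
  also have "\<dots> = (\<Sum>e\<in>edges G. f e * f e) - real (card (edges G)) * c\<^sup>2"
    by (simp add: total power2_eq_square)
  also have "\<dots> \<le> (\<Sum>e\<in>edges G. f e * f e)"
    by simp
  also have "\<dots> = (edge_norm G f)\<^sup>2"
    by (simp add: edge_norm_def edge_inner_def sum_nonneg)
  finally show "energy G g \<le> 2 * (edge_norm G f)\<^sup>2" by simp
qed

lemma iterate_mixing:
  obtains \<rho> where "0 \<le> \<rho>" "\<rho> < 1"
    "\<And>f u v r. v \<in> nbrs G u \<Longrightarrow>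
       ((nb_avg G ^^ r) (\<lambda>(u, v). f {u, v}) (u, v) - (\<Sum>e\<in>edges G. f e) / real (card (edges G)))\<^sup>2
         \<le> \<rho> ^ (r div 2) * (2 * (edge_norm G f)\<^sup>2)"
proof -
  obtain \<rho> where \<rho>: "0 \<le> \<rho>" "\<rho> < 1"
    "\<And>g r. balanced g \<Longrightarrow> energy G ((nb_avg G ^^ r) g) \<le> \<rho> ^ (r div 2) * energy G g"
    using energy_iterate_decay by blast
  have "((nb_avg G ^^ r) (\<lambda>(u, v). f {u, v}) (u, v) - (\<Sum>e\<in>edges G. f e) / real (card (edges G)))\<^sup>2
         \<le> \<rho> ^ (r div 2) * (2 * (edge_norm G f)\<^sup>2)" if uv: "v \<in> nbrs G u" for f u v r
  proof -
    define c where "c = (\<Sum>e\<in>edges G. f e) / real (card (edges G))"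
    define g where "g = (\<lambda>x. (case x of (u, v) \<Rightarrow> f {u, v}) - c)"
    have g: "balanced g" "energy G g \<le> 2 * (edge_norm G f)\<^sup>2"
      unfolding g_def c_def by (rule centred_edge_function)+
    have "((nb_avg G ^^ r) (\<lambda>(u, v). f {u, v}) (u, v) - c)\<^sup>2 = ((nb_avg G ^^ r) g (u, v))\<^sup>2"
      unfolding g_def by (simp only: nb_avg_iterate_diff_const[OF uv])
    also have "\<dots> \<le> energy G ((nb_avg G ^^ r) g)"
      using uv by (rule square_le_energy)
    also have "\<dots> \<le> \<rho> ^ (r div 2) * energy G g"
      using g(1) by (rule \<rho>(3))
    also have "\<dots> \<le> \<rho> ^ (r div 2) * (2 * (edge_norm G f)\<^sup>2)"
      using g(2) \<rho>(1) by (intro mult_left_mono) auto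
    finally show ?thesis by (simp only: c_def)
  qed
  then show thesis using that \<rho>(1,2) by blast
qed

end

section \<open>Arc averages of semiregular graphs\<close>

lemma semiregular_branching:
  assumes "semiregular G p q" and "p \<ge> 2" and "q \<ge> 2"
  obtains A B where "branching_bipartite_graph G A B"
proof -
  obtain A B where AB: "A \<union> B = verts G" "A \<inter> B = {}" "\<forall>e\<in>edges G. \<exists>a\<in>A. \<exists>b\<in>B. e = {a, b}"
    using assms(1) unfolding semiregular_def bipartite_graph_def by blast
  have "branching_bipartite_graph G A B"
  proof
    show "3 \<le> card (nbrs G v)" if "nbrs G v \<noteq> {}" for v
    proof -
      obtain w where "w \<in> nbrs G v" using \<open>nbrs G v \<noteq> {}\<close> by blast
      from semiregular_degree[OF assms(1) this] show ?thesis using assms(2,3) by auto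
    qed
  qed (use AB assms(1) in \<open>auto simp: semiregular_def\<close>)
  then show thesis by (rule that)
qed

theorem theorem3:
  fixes G :: "'a graph" and p q :: nat
  assumes "p \<ge> 2" and "q \<ge> 2" and "semiregular G p q"
  shows "\<exists>C::real. C > 0 \<and> (\<forall>f :: 'a set \<Rightarrow> real.
           \<exists>\<beta> \<in> {real (p * q) powr (- 1 / 2)} \<union> {real (p * q) powr (- 1 / 4) ..< 1}.
             \<forall>a \<in> directed_edges G. \<forall>x0 \<in> verts G. \<forall>b \<in> edge_lifts G x0 a. \<forall>r.
               \<bar>arc_average G x0 r b f - (\<Sum>e\<in>edges G. f e) / real (card (edges G))\<bar>
                 \<le> C * edge_norm G f * \<beta> ^ r)"
proof -
  obtain A B where "branching_bipartite_graph G A B"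
    using semiregular_branching assms by metis
  then interpret branching_bipartite_graph G A B .
  obtain \<rho> where \<rho>: "0 \<le> \<rho>" "\<rho> < 1"
    and mix: "\<And>f u v r. v \<in> nbrs G u \<Longrightarrow>
       ((nb_avg G ^^ r) (\<lambda>(u, v). f {u, v}) (u, v) - (\<Sum>e\<in>edges G. f e) / real (card (edges G)))\<^sup>2
         \<le> \<rho> ^ (r div 2) * (2 * (edge_norm G f)\<^sup>2)"
    using iterate_mixing by blast
  \<comment> \<open>The fourth root turns \<open>\<rho> ^ (r div 2)\<close>, a bound on squares, into a rate per step; enlarging it to \<open>s\<close>
    puts it into the required range and also makes it positive.\<close>
  define s where "s = real (p * q) powr (- 1 / 4)"
  define \<beta> where "\<beta> = max (root 4 \<rho>) s"
  have "2 * 2 \<le> p * q" using assms(1,2) by (rule mult_le_mono)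
  then have "real 1 < real (p * q)" by (simp only: of_nat_less_iff)
  then have pq: "1 < real (p * q)" by (simp only: of_nat_1)
  have "0 < x powr (- 1 / 4) \<and> x powr (- 1 / 4) < 1" if "1 < x" for x :: real
    using that powr_less_one[of x "- 1 / 4"] by simp
  from this[OF pq] have "0 < s" "s < 1" by (simp_all only: s_def)
  then have \<beta>: "0 < \<beta>" "\<beta> < 1" "s \<le> \<beta>"
    using \<rho>(2) by (simp_all add: \<beta>_def less_max_iff_disj)
  have "\<rho> = root 4 \<rho> ^ 4" using \<rho>(1) by simp
  also have "\<dots> \<le> \<beta> ^ 4" using \<rho>(1) by (intro power_mono) (simp_all add: \<beta>_def)
  finally have \<rho>\<beta>: "\<rho> \<le> \<beta> ^ 4" .
  \<comment> \<open>For odd \<open>r\<close> the exponent \<open>r div 2\<close> is rounded down; the division by \<open>\<beta>\<close> pays for it.\<close>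
  have rate: "\<rho> ^ (r div 2) \<le> (\<beta> ^ r / \<beta>)\<^sup>2" for r
  proof -
    have "\<rho> ^ (r div 2) * \<beta>\<^sup>2 \<le> (\<beta> ^ 4) ^ (r div 2) * \<beta>\<^sup>2"
      using \<rho>\<beta> \<rho>(1) by (intro mult_right_mono power_mono) auto
    also have "\<dots> = \<beta> ^ (4 * (r div 2) + 2)" by (simp only: power_mult power_add)
    also have "\<dots> \<le> \<beta> ^ (r * 2)" using \<beta> by (intro power_decreasing) auto
    finally show ?thesis using \<beta>(1) by (simp add: power_divide field_simps flip: power_mult)
  qed
  have bound: "\<bar>arc_average G x0 r b f - (\<Sum>e\<in>edges G. f e) / real (card (edges G))\<bar>
                 \<le> sqrt 2 / \<beta> * edge_norm G f * \<beta> ^ r"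
    if b: "b \<in> edge_lifts G x0 a" for a x0 b r f
  proof -
    obtain w' w where ww: "b = (w', w)" "w' \<in> nbrs (universal_cover G x0) w"
      using b by (cases b) (simp add: edge_lifts_def directed_edges_def nbrs_def insert_commute)
    have "0 \<le> edge_norm G f" by (simp add: edge_norm_def edge_inner_def sum_nonneg)
    then have nonneg: "0 \<le> sqrt 2 / \<beta> * edge_norm G f * \<beta> ^ r"
      using \<beta>(1) by simp
    have "last w \<in> nbrs G (last w')"
      using cover_nbrs_project[OF ww(2)] nbrs_sym by metis
    then have "(arc_average G x0 r b f - (\<Sum>e\<in>edges G. f e) / real (card (edges G)))\<^sup>2
        \<le> \<rho> ^ (r div 2) * (2 * (edge_norm G f)\<^sup>2)"
      using mix by (simp add: ww(1) arc_average_eq_iterate[OF assms(3) ww(2)])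
    also have "\<dots> \<le> (\<beta> ^ r / \<beta>)\<^sup>2 * (2 * (edge_norm G f)\<^sup>2)"
      using rate by (intro mult_right_mono) auto
    also have "\<dots> = (sqrt 2 / \<beta> * edge_norm G f * \<beta> ^ r)\<^sup>2"
      by (simp add: power_mult_distrib power_divide)
    finally show ?thesis
      by (simp only: power2_le_iff_abs_le[OF nonneg])
  qed
  show ?thesis
  proof (intro exI[of _ "sqrt 2 / \<beta>"] conjI allI bexI[of _ \<beta>] ballI)
    show "\<beta> \<in> {real (p * q) powr (- 1 / 2)} \<union> {real (p * q) powr (- 1 / 4) ..< 1}"
      using \<beta> by (simp only: s_def) simp
  qed (use bound \<beta>(1) in auto)
qed

end
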